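(* Let $m$ be a positive integer with $m>\lceil d_\epsilon\rceil+\lceil\tilde d_{\tilde\epsilon}\rceil$. Viewed as a function of $l\in\{0,\ldots,m\}$, the composite Bernstein-Szegö vector $\psi^{(m)}(\xi)=[\psi^{(m)}_l(\xi)]_{0\leq l\leq m}$ solves the eigenvalue equation $$L^{(m)}\psi^{(m)}(\xi)=2\cos(\xi)\,\psi^{(m)}(\xi)$$ for any $\xi\in\{\xi^{(m)}_0,\ldots,\xi^{(m)}_m\}$.
   Context: **Parameters.** Fix nonnegative integers $d,\tilde d$, signs $\epsilon_\pm,\tilde\epsilon_\pm\in\{0,1\}$, and parameters $\alpha_1,\ldots,\alpha_d$ and $\tilde\alpha_1,\ldots,\tilde\alpha_{\tilde d}$ with $0<|\alpha_r|<1$, $0<|\tilde\alpha_r|<1$, where possible complex parameters among the $\alpha_r$ occur in complex conjugate pairs, and likewise for the $\tilde\alpha_r$. Put $d_\epsilon:=\frac12(d-\epsilon_+-\epsilon_-)$ and $\tilde d_{\tilde\epsilon}:=\frac12(\tilde d-\tilde\epsilon_+-\tilde\epsilon_-)$. **Bernstein-Szegö polynomials.** Let $$c(\xi):=(1+\epsilon_+e^{-i\xi})^{-1}(1-\epsilon_-e^{-i\xi})^{-1}\prod_{1\leq r\leq d}(1+\alpha_re^{-i\xi}),\qquad w(\xi):=\frac{1}{2\pi|c(\xi)|^2}\quad(0<\xi<\pi).$$ Let $p_l(\xi)$, $l=0,1,2,\ldots$, be the polynomials of degree $l$ in $\cos\xi$ obtained by Gram-Schmidt orthogonalization of $1,\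 e^{i\xi}+e^{-i\xi},\ e^{2i\xi}+e^{-2i\xi},\ldots$ in $L^2((0,\pi),w(\xi)d\xi)$, normalized so that their expansion in these functions is unitriangular (leading coefficient 1). Put $\Delta_l:=\int_0^\pi p_l^2(\xi)w(\xi)\,d\xi$ and $\mathtt p_l(\xi):=\Delta_l^{-1}p_l(\xi)$. These satisfy a three-term recurrence $$2\cos(\xi)\mathtt p_l(\xi)=\mathtt p_{l-1}(\xi)+b_l\mathtt p_l(\xi)+a_{l+1}^2\mathtt p_{l+1}(\xi),\qquad a_{l+1}:=(\Delta_{l+1}/\Delta_l)^{1/2},\quad \mathtt p_{-1}:=0,$$ which defines the real coefficients $b_l$ ($l\geq0$). The objects $\tilde c(\xi)$, $\tilde\Delta_l$, $\tilde{\mathtt p}_l(\xi)$, $\tilde a_{l+1}$, $\tilde b_l$ are defined in the same way from $\tilde d,\tilde\epsilon_\pm,\tilde\alpha_r$. **Nodes.** For $|\alpha|<1$ let $u_\alpha(x):=\frac{1-\alpha^2}{1+2\alpha\cos(x)+\alpha^2}$. For a positive integer $m>\lceil d_\epsilon\rceil+\lceil\tilde d_{\tilde\epsilon}\rceil$ and $\hat l\in\{0,\ldots,m\}$, $\xi^{(m)}_{\hat l}$ denotes the unique real solution $\xi$ of $$2(m-d_\epsilon-\tilde d_{\tilde\epsilon})\xi+\sum_{1\leq r\leq d}\int_0^\xi u_{\alpha_r}(x)dx+\sum_{1\leq r\leq\tilde d}\int_0^\xi u_{\tilde\alpha_r}(x)dx=\pi(2\hat l+\epsilon_-+\tilde\epsilon_-).$$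 One has $0\leq\xi^{(m)}_0<\xi^{(m)}_1<\cdots<\xi^{(m)}_m\leq\pi$, and the nodes are never poles of $c(\pm\xi)$ or $\tilde c(\pm\xi)$. **Composite basis.** For $\xi\in\{\xi^{(m)}_0,\ldots,\xi^{(m)}_m\}$ and $l\in\{0,\ldots,m\}$, $$\psi^{(m)}_l(\xi):=\begin{cases}e^{\frac i2m\xi}\,\dfrac{\mathtt p_l(\xi)}{c(-\xi)}&\text{if }0\leq l<d_\epsilon,\\[2mm] e^{\frac i2m\xi}\,\dfrac{\mathtt p_l(\xi)}{c(-\xi)}=e^{-\frac i2m\xi}\,\dfrac{\tilde{\mathtt p}_{m-l}(\xi)}{\tilde c(\xi)}&\text{if }d_\epsilon\leq l\leq m-\tilde d_{\tilde\epsilon},\\[2mm] e^{-\frac i2m\xi}\,\dfrac{\tilde{\mathtt p}_{m-l}(\xi)}{\tilde c(\xi)}&\text{if }m-\tilde d_{\tilde\epsilon}<l\leq m\end{cases}$$ (the two expressions in the middle case agree at the nodes). **The matrix $L^{(m)}$.** $L^{(m)}=[L^{(m)}_{l,k}]_{0\leq l,k\leq m}$ is the tridiagonal matrix with $$L^{(m)}_{l,k}:=\begin{cases}\delta_{l-k-1}+b_l\delta_{l-k}+a_{l+1}^2\delta_{l-k+1}&\text{if }0\leq l\leq\lceil d_\epsilon\rceil,\\ \delta_{l-k-1}+\delta_{l-k+1}&\text{if }\lceil d_\epsilon\rceil<l<m-\lceil\tilde d_{\tilde\epsilon}\rceil,\\ \tilde a_{m-l+1}^2\delta_{l-k-1}+\tilde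 b_{m-l}\delta_{l-k}+\delta_{l-k+1}&\text{if }m-\lceil\tilde d_{\tilde\epsilon}\rceil\leq l\leq m,\end{cases}$$ where $\delta_x:=1$ if $x=0$ and $\delta_x:=0$ otherwise. It acts on column vectors $[f_l]_{0\leq l\leq m}$ by matrix multiplication. *)

theory Defs
  imports "HOL-Analysis.Interval_Integral" "HOL-Library.Multiset" "Jordan_Normal_Form.Matrix"
begin

record bs_params =
  eps_plus :: nat
  eps_minus :: nat
  alphas :: "complex list"

text \<open>Invariance of the multiset of parameters under conjugation says that the nonreal ones occur
  in conjugate pairs, counted with multiplicity.\<close>

definition bs_admissible :: "bs_params \<Rightarrow> bool" where
  "bs_admissible P \<longleftrightarrow>
     eps_plus P \<in> {0, 1} \<and> eps_minus P \<in> {0, 1} \<and>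
     (\<forall>\<alpha>\<in>set (alphas P). 0 < cmod \<alpha> \<and> cmod \<alpha> < 1) \<and>
     image_mset cnj (mset (alphas P)) = mset (alphas P)"

text \<open>This half-integer may be negative, as low as -1.\<close>

definition d_eps :: "bs_params \<Rightarrow> real" where
  "d_eps P = (real (length (alphas P)) - real (eps_plus P) - real (eps_minus P)) / 2"

definition bs_c :: "bs_params \<Rightarrow> real \<Rightarrow> complex" where
  "bs_c P \<xi> =
     inverse (1 + of_nat (eps_plus P) * exp (- \<i> * of_real \<xi>)) *
     inverse (1 - of_nat (eps_minus P) * exp (- \<i> * of_real \<xi>)) *
     (\<Prod>\<alpha>\<leftarrow>alphas P. 1 + \<alpha> * exp (- \<i> * of_real \<xi>))"

definition bs_w :: "bs_params \<Rightarrow> real \<Rightarrow> real" where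
  "bs_w P \<xi> = 1 / (2 * pi * (cmod (bs_c P \<xi>))\<^sup>2)"

definition bs_inner :: "bs_params \<Rightarrow> (real \<Rightarrow> real) \<Rightarrow> (real \<Rightarrow> real) \<Rightarrow> real" where
  "bs_inner P f g = (LBINT \<xi>=0..pi. f \<xi> * g \<xi> * bs_w P \<xi>)"

text \<open>The functions \<open>1\<close> and \<open>exp (i l \<xi>) + exp (- i l \<xi>) = 2 cos (l \<xi>)\<close> for \<open>l \<ge> 1\<close>.\<close>

definition cos_basis :: "nat \<Rightarrow> real \<Rightarrow> real" where
  "cos_basis l \<xi> = (if l = 0 then 1 else 2 * cos (real l * \<xi>))"

text \<open>Gram-Schmidt orthogonalization without rescaling, so that the expansion in
  \<^const>\<open>cos_basis\<close> is unitriangular.\<close>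

fun bs_p :: "bs_params \<Rightarrow> nat \<Rightarrow> real \<Rightarrow> real" where
  "bs_p P l = (\<lambda>\<xi>. cos_basis l \<xi> -
     (\<Sum>k<l. bs_inner P (cos_basis l) (bs_p P k) / bs_inner P (bs_p P k) (bs_p P k) * bs_p P k \<xi>))"

declare bs_p.simps [simp del]

definition bs_Delta :: "bs_params \<Rightarrow> nat \<Rightarrow> real" where
  "bs_Delta P l = (LBINT \<xi>=0..pi. (bs_p P l \<xi>)\<^sup>2 * bs_w P \<xi>)"

definition bs_pn :: "bs_params \<Rightarrow> nat \<Rightarrow> real \<Rightarrow> real" where
  "bs_pn P l \<xi> = bs_p P l \<xi> / bs_Delta P l"

text \<open>Only meaningful for \<open>l \<ge> 1\<close>.\<close>

definition bs_a :: "bs_params \<Rightarrow> nat \<Rightarrow> real" where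
  "bs_a P l = sqrt (bs_Delta P l / bs_Delta P (l - 1))"

definition bs_b :: "bs_params \<Rightarrow> nat \<Rightarrow> real" where
  "bs_b P l = (THE b. \<forall>\<xi>. 2 * cos \<xi> * bs_pn P l \<xi> =
     (if l = 0 then 0 else bs_pn P (l - 1) \<xi>) + b * bs_pn P l \<xi> +
     (bs_a P (l + 1))\<^sup>2 * bs_pn P (l + 1) \<xi>)"

definition bs_u :: "complex \<Rightarrow> real \<Rightarrow> complex" where
  "bs_u \<alpha> x = (1 - \<alpha>\<^sup>2) / (1 + 2 * \<alpha> * of_real (cos x) + \<alpha>\<^sup>2)"

text \<open>The defining equation of the node is stated over the complex numbers, since the individual
  integrals are complex for nonreal parameters. The integrals are oriented, so that negative
  \<open>\<xi>\<close> are treated correctly.\<close>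

definition bs_node :: "bs_params \<Rightarrow> bs_params \<Rightarrow> nat \<Rightarrow> nat \<Rightarrow> real" where
  "bs_node P Q m j = (THE \<xi>::real.
     complex_of_real (2 * (real m - d_eps P - d_eps Q) * \<xi>) +
     (\<Sum>\<alpha>\<leftarrow>alphas P. LBINT x=0..\<xi>. bs_u \<alpha> x) +
     (\<Sum>\<alpha>\<leftarrow>alphas Q. LBINT x=0..\<xi>. bs_u \<alpha> x) =
     complex_of_real (pi * (2 * real j + real (eps_minus P) + real (eps_minus Q))))"

text \<open>For \<open>d_eps P \<le> l \<le> m - d_eps Q\<close> the two expressions agree at the nodes; here
  the first one is used on that range.\<close>

definition bs_psi :: "bs_params \<Rightarrow> bs_params \<Rightarrow> nat \<Rightarrow> real \<Rightarrow> complex Matrix.vec" where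
  "bs_psi P Q m \<xi> = Matrix.vec (m + 1) (\<lambda>l.
     if real l \<le> real m - d_eps Q
     then exp (\<i> / 2 * of_nat m * of_real \<xi>) * (of_real (bs_pn P l \<xi>) / bs_c P (- \<xi>))
     else exp (- \<i> / 2 * of_nat m * of_real \<xi>) * (of_real (bs_pn Q (m - l) \<xi>) / bs_c Q \<xi>))"

definition bs_L_entry :: "bs_params \<Rightarrow> bs_params \<Rightarrow> nat \<Rightarrow> nat \<Rightarrow> nat \<Rightarrow> real" where
  "bs_L_entry P Q m l k =
     (if int l \<le> \<lceil>d_eps P\<rceil> then
        of_bool (l = k + 1) + bs_b P l * of_bool (l = k) + (bs_a P (l + 1))\<^sup>2 * of_bool (l + 1 = k)
      else if int l < int m - \<lceil>d_eps Q\<rceil> then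
        of_bool (l = k + 1) + of_bool (l + 1 = k)
      else
        (bs_a Q (m - l + 1))\<^sup>2 * of_bool (l = k + 1) + bs_b Q (m - l) * of_bool (l = k) +
        of_bool (l + 1 = k))"

definition bs_L :: "bs_params \<Rightarrow> bs_params \<Rightarrow> nat \<Rightarrow> complex Matrix.mat" where
  "bs_L P Q m = Matrix.mat (m + 1) (m + 1) (\<lambda>(l, k). complex_of_real (bs_L_entry P Q m l k))"

end

theory Submission
  imports Defs "HOL-Complex_Analysis.Cauchy_Integral_Formula" "HOL-Computational_Algebra.Polynomial"
begin

text \<open>Above the index \<open>d_eps\<close> the normalized polynomials are plane waves: expanding shows that
  \<open>c(\<xi>) exp (i l \<xi>) + c(- \<xi>) exp (- i l \<xi>)\<close> is a polynomial of degree at most \<open>l\<close> in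
  \<open>2 cos \<xi>\<close> as soon as \<open>l \<ge> d_eps\<close>, and since \<open>1 / c(- \<xi>)\<close> is holomorphic in the disc
  \<open>|exp (i \<xi>)| \<le> 1\<close> with value 1 at the centre, Cauchy's formula computes its inner products with
  the first \<open>l + 1\<close> cosines. Exponentiating the equation of a node gives the quantization condition
  \<open>exp (2 i m \<xi>) (c(\<xi>) / c(- \<xi>)) (c'(\<xi>) / c'(- \<xi>)) = 1\<close>, with \<open>c'\<close> for the second parameter
  set, which makes the two halves of \<open>\<psi>\<close> agree on their overlap. Every row of the matrix then
  is either a three-term recurrence or the free equation for plane waves.\<close>

section \<open>Monic orthogonal polynomials\<close>

text \<open>Uniqueness replaces computation: a polynomial of degree at most l whose pairings with
  the first l + 1 cosines are 0, ..., 0, 1 must be the orthogonal polynomial divided by its squared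
  norm. The final 1 is the reason why the normalization by \<open>bs_Delta\<close> gives plane waves
  without a prefactor. Orthogonality is therefore treated abstractly, for a functional on real
  polynomials in the variable 2 cos \<xi> that is positive on squares. Below \<open>d_eps\<close>
  only the recurrence is available. Two obstacles shape the rest. The function c may have poles at
  the end points 0 and pi, so its reciprocal is the basic object. And the nodes are given by a
  definite description with complex integrals, so existence, uniqueness and location in [0, pi] come
  before any other statement about them.\<close>

locale positive_functional =
  fixes L :: "real poly \<Rightarrow> real" and C :: "nat \<Rightarrow> real poly"
  assumes L_add: "L (f + g) = L f + L g"
    and L_smult: "L (smult c f) = c * L f"
    and L_pos: "f \<noteq> 0 \<Longrightarrow> L (f * f) > 0"
    and C_lead: "coeff (C n) n = 1"
    and C_degree: "i > n \<Longrightarrow> coeff (C n) i = 0"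
begin

text \<open>The same recursion as \<open>bs_p\<close>, with polynomials in place of functions, so
  that the two are matched by a plain induction in \<open>bs_p_poly\<close>.\<close>

fun B :: "nat \<Rightarrow> real poly" where
  "B l = C l - (\<Sum>k<l. smult (L (C l * B k) / L (B k * B k)) (B k))"

declare B.simps [simp del]

lemma L_0: "L 0 = 0"
  using L_smult[of 0 0] by simp

lemma L_minus: "L (- f) = - L f"
  using L_smult[of "-1" f] by simp

lemma L_diff: "L (f - g) = L f - L g"
  using L_add[of f "- g"] by (simp add: L_minus)

lemma L_sum: "L (\<Sum>i\<in>A. f i) = (\<Sum>i\<in>A. L (f i))"
  by (induction A rule: infinite_finite_induct) (auto simp: L_0 L_add)

lemma eq_0_if_L_square: "L (f * f) = 0 \<Longrightarrow> f = 0"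
  using L_pos[of f] by fastforce

lemma B_degree: "i > l \<Longrightarrow> coeff (B l) i = 0"
proof (induction l rule: less_induct)
  case (less l)
  then show ?case
    by (subst B.simps) (simp add: C_degree coeff_sum)
qed

lemma B_lead: "coeff (B l) l = 1"
  by (subst B.simps) (simp add: C_lead coeff_sum B_degree)

lemma B_nonzero: "B l \<noteq> 0"
  using B_lead[of l] by auto

lemma norm_pos: "L (B l * B l) > 0"
  by (intro L_pos B_nonzero)

lemma B_orth: "k < l \<Longrightarrow> L (B l * B k) = 0"
proof (induction l arbitrary: k rule: less_induct)
  case (less l)
  have *: "L (B j * B k) = 0" if "j < l" "j \<noteq> k" for j
    using less.IH[of j k] less.IH[of k j] that less.prems
    by (metis linorder_neqE_nat mult.commute)
  have "L (B l * B k) = L (C l * B k) -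
      (\<Sum>j<l. L (C l * B j) / L (B j * B j) * L (B j * B k))"
    by (subst B.simps) (simp add: left_diff_distrib sum_distrib_right L_diff L_sum L_smult)
  also have "(\<Sum>j<l. L (C l * B j) / L (B j * B j) * L (B j * B k)) =
      (\<Sum>j<l. if j = k then L (C l * B k) else 0)"
    using * norm_pos[of k] by (intro sum.cong) auto
  finally show ?case
    using less.prems by simp
qed

text \<open>Any monic family with one member in each degree spans the polynomials of degree below n;
  the induction strips off the leading term of \<open>f\<close>. The family is left general because
  both \<open>B\<close> and \<open>C\<close> are inserted for it.\<close>

lemma orthogonal_lower_degree:
  assumes lead: "\<And>k. coeff (A k) k = 1" and deg: "\<And>k i. i > k \<Longrightarrow> coeff (A k) i = 0"
    and orth: "\<And>k. k < n \<Longrightarrow> L (A k * g) = 0"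
    and f: "\<And>i. i \<ge> n \<Longrightarrow> coeff f i = 0"
  shows "L (f * g) = 0"
  using orth f
proof (induction n arbitrary: f)
  case 0
  then have "f = 0"
    by (intro poly_eqI) simp
  then show ?case
    by (simp add: L_0)
next
  case (Suc n)
  define h where "h = f - smult (coeff f n) (A n)"
  have "coeff h i = 0" if "i \<ge> n" for i
    using that Suc.prems(2)[of i] lead[of n] deg[of n i]
    by (cases "i = n") (auto simp: h_def)
  then have "L (h * g) = 0"
    using Suc by simp
  moreover have "h * g = f * g - smult (coeff f n) (A n * g)"
    by (simp add: h_def algebra_simps)
  ultimately show ?case
    using Suc.prems(1)[of n] by (simp add: L_diff L_smult)
qed

lemma B_orth_lower: "(\<And>i. i \<ge> l \<Longrightarrow> coeff f i = 0) \<Longrightarrow> L (f * B l) = 0"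
  by (rule orthogonal_lower_degree[of B l])
    (use B_orth in \<open>auto simp: B_lead B_degree mult.commute[of "B _" "B l"]\<close>)

text \<open>After subtracting the right multiple of \<open>B l\<close>, the rest \<open>g\<close>
  has degree below l. It is orthogonal to \<open>f\<close> and to \<open>B l\<close>, hence to
  itself, and positivity makes it 0. The pairing with \<open>C l\<close> then fixes the multiple,
  since \<open>C l\<close> and \<open>B l\<close> differ only in lower degree. This is the criterion
  by which an explicit formula is recognized.\<close>

lemma eq_normalized_B:
  assumes deg: "\<And>i. i > l \<Longrightarrow> coeff f i = 0"
    and orth: "\<And>k. k < l \<Longrightarrow> L (C k * f) = 0" and "L (C l * f) = 1"
  shows "f = smult (1 / L (B l * B l)) (B l)"
proof -
  define \<kappa> where "\<kappa> = coeff f l"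
  define g where "g = f - smult \<kappa> (B l)"
  have g_low: "coeff g i = 0" if "i \<ge> l" for i
    using that deg[of i] B_lead[of l] B_degree[of l i] by (cases "i = l") (auto simp: g_def \<kappa>_def)
  have "L (g * f) = 0"
    by (rule orthogonal_lower_degree[of C l]) (auto simp: C_lead C_degree orth g_low)
  moreover have "L (g * B l) = 0"
    by (rule B_orth_lower) (rule g_low)
  moreover have "g * g = g * f - smult \<kappa> (g * B l)"
    by (subst (2) g_def) (simp add: algebra_simps)
  ultimately have "g = 0"
    by (intro eq_0_if_L_square) (simp add: L_diff L_smult)
  then have f: "f = smult \<kappa> (B l)"
    by (simp add: g_def)
  have "L ((C l - B l) * B l) = 0"
  proof (rule B_orth_lower)
    fix i assume "i \<ge> l"
    then show "coeff (C l - B l) i = 0"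
      using C_lead[of l] B_lead[of l] C_degree[of l i] B_degree[of l i] by (cases "i = l") auto
  qed
  then have "L (C l * B l) = L (B l * B l)"
    by (simp add: left_diff_distrib L_diff)
  with assms(3) have "\<kappa> * L (B l * B l) = 1"
    by (simp add: f L_smult)
  then have "\<kappa> = 1 / L (B l * B l)"
    by (auto simp: eq_divide_eq)
  with f show ?thesis
    by simp
qed

text \<open>Both coefficients are forced: \<beta> by pairing with \<open>B l\<close>, the other one
  by pairing with \<open>B (l - 1)\<close>. The remainder \<open>g\<close> has degree at most l
  because the leading terms in degree l + 1 cancel, and it is orthogonal to \<open>B 0\<close>, ...,
  \<open>B l\<close>, so it vanishes.\<close>

lemma three_term_recurrence:
  "\<exists>\<beta>. [:0, 1:] * B l =
     (if l = 0 then 0 else smult (L (B l * B l) / L (B (l - 1) * B (l - 1))) (B (l - 1))) +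
     smult \<beta> (B l) + B (Suc l)"
proof -
  let ?D = "\<lambda>k. L (B k * B k)"
  define \<beta> where "\<beta> = L ([:0, 1:] * B l * B l) / ?D l"
  define low where "low = (if l = 0 then 0 else smult (?D l / ?D (l - 1)) (B (l - 1)))"
  define g where "g = [:0, 1:] * B l - low - smult \<beta> (B l) - B (Suc l)"
  have X: "coeff ([:0, 1:] * f) i = (if i = 0 then 0 else coeff f (i - 1))" for f :: "real poly" and i
    by (cases i) auto
  have D: "?D k \<noteq> 0" for k
    using norm_pos[of k] by simp
  have deg: "coeff g i = 0" if "i \<ge> Suc l" for i
    unfolding g_def coeff_diff X using that B_degree[of l i] B_degree[of "l - 1" i] B_degree[of l "i - 1"] B_lead[of l]
      B_lead[of "Suc l"] B_degree[of "Suc l" i]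
    by (cases "i = Suc l") (auto simp: low_def)
  have orth: "L (B k * g) = 0" if "k < Suc l" for k
  proof -
    have gk: "L (B k * g) = L ([:0, 1:] * B k * B l) - L (B k * low) - \<beta> * L (B k * B l)"
    proof -
      have "B k * g = [:0, 1:] * B k * B l - B k * low - smult \<beta> (B k * B l) - B (Suc l) * B k"
        by (simp add: g_def algebra_simps)
      then show ?thesis
        using B_orth[OF that] by (simp add: L_diff L_smult)
    qed
    have lowk: "L (B k * low) = (if l \<noteq> 0 \<and> k = l - 1 then ?D l else 0)"
    proof (cases "l \<noteq> 0 \<and> k \<noteq> l - 1")
      case True
      then have "L (B k * B (l - 1)) = 0"
        using B_orth[of k "l - 1"] B_orth[of "l - 1" k] by (metis linorder_neqE_nat mult.commute)
      with True show ?thesis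
        by (simp add: low_def L_smult)
    next
      case False
      then show ?thesis
        using D[of "l - 1"] by (auto simp: low_def L_smult L_0)
    qed
    have "k = l \<or> (l \<noteq> 0 \<and> k = l - 1) \<or> Suc k < l"
      using that by linarith
    then consider "k = l" | "l \<noteq> 0" "k = l - 1" | "Suc k < l"
      by blast
    then show ?thesis
    proof cases
      case 1
      then show ?thesis
        using D[of l] gk lowk by (auto simp: \<beta>_def)
    next
      case 2
      \<comment> \<open>Here k = l - 1, so both polynomials are monic of degree l and their
        difference has lower degree. This produces the numerator of the coefficient in
        \<open>low\<close>.\<close>
      have "L (([:0, 1:] * B k - B l) * B l) = 0"
      proof (rule B_orth_lower)
        fix i assume "i \<ge> l"
        then show "coeff ([:0, 1:] * B k - B l) i = 0"
          unfolding coeff_diff X using 2 B_lead[of k] B_lead[of l] B_degree[of l i] B_degree[of k "i - 1"]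
          by (cases "i = l") auto
      qed
      then have "L ([:0, 1:] * B k * B l) = ?D l"
        by (simp add: left_diff_distrib L_diff)
      moreover have "L (B k * B l) = 0"
        using B_orth[of k l] 2 by (simp add: mult.commute)
      ultimately show ?thesis
        using gk lowk 2 by simp
    next
      case 3
      have "L ([:0, 1:] * B k * B l) = 0"
      proof (rule B_orth_lower)
        fix i assume "i \<ge> l"
        then show "coeff ([:0, 1:] * B k) i = 0"
          unfolding X using 3 B_degree[of k "i - 1"] by auto
      qed
      moreover have "L (B k * B l) = 0"
        using B_orth[of k l] 3 by (simp add: mult.commute)
      ultimately show ?thesis
        using gk lowk 3 by simp
    qed
  qed
  have "L (g * g) = 0"
    by (rule orthogonal_lower_degree[of B "Suc l"]) (auto simp: B_lead B_degree orth deg)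
  then have "g = 0"
    by (rule eq_0_if_L_square)
  then have "[:0, 1:] * B l = low + smult \<beta> (B l) + B (Suc l)"
    by (simp add: g_def algebra_simps)
  then show ?thesis
    unfolding low_def by blast
qed

end

section \<open>The inner product of Bernstein-Szego polynomials\<close>

text \<open>Cauchy's formula at the centre is the mean value property on the full circle. The
  symmetry under conjugation makes the real part invariant under t -> 2 pi - t, so the upper half
  circle carries half of the integral.\<close>

lemma has_integral_Re_circle:
  fixes h :: "complex \<Rightarrow> complex"
  assumes cont: "continuous_on (cball 0 1) h" and hol: "h holomorphic_on ball 0 1"
    and cnj: "\<And>z. cmod z = 1 \<Longrightarrow> h (cnj z) = cnj (h z)"
  shows "((\<lambda>t. Re (h (cis t))) has_integral pi * Re (h 0)) {0..pi}"
proof -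
  define f where "f = (\<lambda>t. Re (h (cis t)))"
  have "((\<lambda>u. h u / (u - 0)) has_contour_integral (2 * of_real pi * \<i> * h 0)) (circlepath 0 1)"
    by (rule Cauchy_integral_circlepath[OF cont hol]) simp
  then have "((\<lambda>t. h (0 + 1 * cis t) / (0 + 1 * cis t) * 1 * \<i> * cis t) has_integral 2 * of_real pi * \<i> * h 0) {0..2 * pi}"
    unfolding circlepath_def by (subst (asm) has_contour_integral_part_circlepath_iff) auto
  then have "((\<lambda>t. \<i> * h (cis t)) has_integral 2 * of_real pi * \<i> * h 0) {0..2 * pi}"
    by (rule has_integral_eq[rotated]) (simp add: field_simps)
  from has_integral_mult_right[OF this, of "- \<i>"]
  have "((\<lambda>t. h (cis t)) has_integral of_real (2 * pi) * h 0) {0..2 * pi}"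
    by (simp add: algebra_simps)
  from has_integral_Re[OF this] have total: "(f has_integral 2 * (pi * Re (h 0))) {0..2 * pi}"
    by (simp add: f_def mult.assoc)
  then have int: "f integrable_on {0..2 * pi}"
    by blast
  have "f integrable_on {0..pi}"
    by (rule integrable_subinterval_real[OF int]) auto
  then obtain I where I: "(f has_integral I) {0..pi}"
    by blast
  have "f integrable_on {pi..2 * pi}"
    by (rule integrable_subinterval_real[OF int]) auto
  then obtain J where J: "(f has_integral J) {pi..2 * pi}"
    by blast
  have refl: "f (2 * pi - t) = f t" for t
  proof -
    have "cis (2 * pi - t) = cnj (cis t)"
      by (simp add: cis_cnj complex_eq_iff cos_diff sin_diff)
    then show ?thesis
      using cnj[of "cis t"] by (simp add: f_def)
  qed
  have "((\<lambda>x. f (-1 *\<^sub>R x + 2 * pi)) has_integral J) {0..pi}"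
    using has_integral_affinity[of f J pi "2 * pi" "-1" "2 * pi"] J
    by (simp add: image_affinity_cbox)
  then have "(f has_integral J) {0..pi}"
    using refl by (simp add: add.commute)
  with I have "J = I"
    using has_integral_unique by blast
  have "(f has_integral I + J) {0..2 * pi}"
    by (rule has_integral_combine[OF _ _ I J]) auto
  then have "I + J = 2 * (pi * Re (h 0))"
    by (rule has_integral_unique[OF _ total])
  with \<open>J = I\<close> have "I = pi * Re (h 0)"
    by simp
  with I show ?thesis
    by (simp add: f_def)
qed

text \<open>The reciprocal of the paper's \<open>c(\<xi>)\<close> as a function of \<open>z = exp (- i \<xi>)\<close>.\<close>

definition szego :: "bs_params \<Rightarrow> complex \<Rightarrow> complex" where
  "szego P z = (1 + of_nat (eps_plus P) * z) * (1 - of_nat (eps_minus P) * z) / (\<Prod>\<alpha>\<leftarrow>alphas P. 1 + \<alpha> * z)"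

section \<open>Conjugation symmetry and zeros of the reciprocal of c\<close>

lemma exp_minus_i: "exp (- \<i> * complex_of_real x) = cis (- x)"
  by (simp add: cis_conv_exp)

text \<open>At a pole of c both sides are 0 by the convention \<open>inverse 0 = 0\<close>.
  Regularity of c is from here on expressed as \<open>szego\<close> being nonzero.\<close>

lemma bs_c_szego: "bs_c P \<xi> = inverse (szego P (cis (- \<xi>)))"
  unfolding bs_c_def szego_def exp_minus_i by (simp add: field_simps)

lemma bs_w_szego: "bs_w P \<xi> = (cmod (szego P (cis (- \<xi>))))\<^sup>2 / (2 * pi)"
  unfolding bs_w_def bs_c_szego by (simp add: inverse_eq_divide norm_divide power_divide)

lemma cnj_prod_list: "cnj (prod_list xs) = prod_list (map cnj xs)"
  by (induction xs) auto

lemma prod_list_alphas_cnj: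
  assumes "bs_admissible P"
  shows "(\<Prod>\<alpha>\<leftarrow>alphas P. f (cnj \<alpha>)) = (\<Prod>\<alpha>\<leftarrow>alphas P. (f \<alpha> :: complex))"
proof -
  have "mset (map f (map cnj (alphas P))) = mset (map f (alphas P))"
    using assms unfolding bs_admissible_def by (simp only: mset_map)
  then have "prod_list (map f (map cnj (alphas P))) = prod_list (map f (alphas P))"
    by (metis prod_mset_prod_list)
  then show ?thesis
    by (simp add: o_def)
qed

text \<open>Conjugation permutes the parameters and leaves the product unchanged: the rational
  function has real coefficients.\<close>

lemma szego_cnj:
  assumes "bs_admissible P"
  shows "szego P (cnj z) = cnj (szego P z)"
proof -
  have "cnj (\<Prod>\<alpha>\<leftarrow>alphas P. 1 + \<alpha> * z) = (\<Prod>\<alpha>\<leftarrow>alphas P. 1 + cnj \<alpha> * cnj z)"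
    by (simp add: cnj_prod_list o_def)
  also have "\<dots> = (\<Prod>\<alpha>\<leftarrow>alphas P. 1 + \<alpha> * cnj z)"
    by (rule prod_list_alphas_cnj[OF assms])
  finally show ?thesis
    by (simp add: szego_def)
qed

lemma alpha_factor_nonzero:
  assumes "cmod \<alpha> < 1" "cmod z \<le> 1"
  shows "1 + \<alpha> * z \<noteq> 0"
proof
  assume "1 + \<alpha> * z = 0"
  then have "cmod (\<alpha> * z) = 1"
    by (metis add_eq_0_iff norm_minus_cancel norm_one)
  moreover have "cmod (\<alpha> * z) \<le> cmod \<alpha>"
    using assms by (simp add: norm_mult mult_left_le)
  ultimately show False
    using assms by simp
qed

lemma alpha_prod_nonzero:
  assumes "bs_admissible P" "cmod z \<le> 1"
  shows "(\<Prod>\<alpha>\<leftarrow>alphas P. 1 + \<alpha> * z) \<noteq> 0"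
  using assms alpha_factor_nonzero unfolding bs_admissible_def by (auto simp: prod_list_zero_iff)

lemma prod_list_holomorphic: "(\<lambda>z. \<Prod>\<alpha>\<leftarrow>xs. 1 + \<alpha> * z) holomorphic_on S"
  by (induction xs) (auto intro!: holomorphic_intros)

lemma szego_holomorphic:
  assumes "bs_admissible P"
  shows "szego P holomorphic_on cball 0 1"
  unfolding szego_def using alpha_prod_nonzero[OF assms]
  by (intro holomorphic_intros prod_list_holomorphic) auto

lemma szego_0: "szego P 0 = 1"
proof -
  have "(\<Prod>\<alpha>\<leftarrow>xs. 1 + \<alpha> * 0) = (1 :: complex)" for xs
    by (induction xs) auto
  then show ?thesis
    unfolding szego_def by simp
qed

text \<open>The \<alpha>-factors have no zero in the closed disc, so on the circle only the two sign
  factors can vanish.\<close>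

lemma szego_nonzero_iff:
  assumes "bs_admissible P" "cmod z = 1"
  shows "szego P z \<noteq> 0 \<longleftrightarrow> (eps_plus P = 1 \<longrightarrow> z \<noteq> -1) \<and> (eps_minus P = 1 \<longrightarrow> z \<noteq> 1)"
proof -
  have "1 + z = 0 \<longleftrightarrow> z = -1" "1 - z = 0 \<longleftrightarrow> z = 1"
    by (auto simp: add_eq_0_iff)
  moreover have "eps_plus P = 0 \<or> eps_plus P = 1" "eps_minus P = 0 \<or> eps_minus P = 1"
    using assms(1) by (auto simp: bs_admissible_def)
  ultimately show ?thesis
    using alpha_prod_nonzero[OF assms(1), of z] assms(2) by (auto simp: szego_def)
qed

lemma cis_eq_1_iff: "0 \<le> x \<Longrightarrow> x \<le> pi \<Longrightarrow> cis x = 1 \<longleftrightarrow> x = 0"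
  using cos_inj_pi[of x 0] by (auto simp: complex_eq_iff)

lemma cis_eq_minus_1_iff: "0 \<le> x \<Longrightarrow> x \<le> pi \<Longrightarrow> cis x = - 1 \<longleftrightarrow> x = pi"
  using cos_inj_pi[of x pi] by (auto simp: complex_eq_iff)

lemma continuous_on_szego_cis:
  assumes "bs_admissible P" "continuous_on S f"
  shows "continuous_on S (\<lambda>x. szego P (cis (f x)))"
proof -
  have "continuous_on (cball 0 1) (szego P)"
    using szego_holomorphic[OF assms(1)] by (rule holomorphic_on_imp_continuous_on)
  then show ?thesis
    by (rule continuous_on_compose2) (auto intro!: continuous_intros assms)
qed

lemma continuous_on_bs_w: "bs_admissible P \<Longrightarrow> continuous_on S (bs_w P)"
  unfolding bs_w_szego by (intro continuous_intros continuous_on_szego_cis) auto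

lemma bs_w_nonneg: "bs_w P x \<ge> 0"
  by (simp add: bs_w_szego)

lemma szego_minus_nonzero:
  "bs_admissible P \<Longrightarrow> szego P (cis (- \<xi>)) \<noteq> 0 \<longleftrightarrow> szego P (cis \<xi>) \<noteq> 0"
  using szego_cnj[of P "cis \<xi>"] by (simp add: cis_cnj)

lemma szego_nonzero_interior:
  assumes "bs_admissible P" "0 < \<xi>" "\<xi> < pi"
  shows "szego P (cis \<xi>) \<noteq> 0"
  using assms by (subst szego_nonzero_iff) (auto simp: cis_eq_1_iff cis_eq_minus_1_iff)

lemma bs_w_pos: "bs_admissible P \<Longrightarrow> 0 < \<xi> \<Longrightarrow> \<xi> < pi \<Longrightarrow> bs_w P \<xi> > 0"
  using szego_nonzero_interior[of P \<xi>] szego_minus_nonzero[of P \<xi>] by (simp add: bs_w_szego)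

section \<open>Transfer from trigonometric functions to polynomials in 2 cos x\<close>

fun cos_poly :: "nat \<Rightarrow> real poly" where
  "cos_poly 0 = 1"
| "cos_poly (Suc 0) = [:0, 1:]"
| "cos_poly (Suc (Suc n)) = [:0, 1:] * cos_poly (Suc n) - (if n = 0 then 2 else cos_poly n)"

lemma coeff_X_mult: "coeff ([:0, 1:] * f) i = (if i = 0 then 0 else coeff f (i - 1))"
  for f :: "'a::comm_semiring_1 poly"
  by (cases i) auto

lemma cos_poly_coeff: "coeff (cos_poly n) n = 1 \<and> (\<forall>i>n. coeff (cos_poly n) i = 0)"
proof (induction n rule: cos_poly.induct)
  case (3 n)
  have "coeff (2::real poly) i = 0" if "i > 0" for i
    using that by (metis degree_numeral coeff_eq_0)
  with 3 show ?case
    unfolding cos_poly.simps(3) coeff_diff coeff_X_mult by auto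
qed (auto simp: coeff_pCons split: nat.split)

text \<open>These are Chebyshev polynomials of the first kind, rescaled to be monic in 2 cos x. The
  exception for n = 0 in their recursion arises because the basis starts with 1 instead of 2 cos 0 =
  2.\<close>

lemma poly_cos_poly: "poly (cos_poly n) (2 * cos x) = cos_basis n x"
proof (induction n rule: cos_poly.induct)
  case (3 n)
  have "cos (real (Suc (Suc n)) * x) + cos (real n * x) = 2 * cos x * cos (real (Suc n) * x)"
    using cos_add[of "real (Suc n) * x" x] cos_diff[of "real (Suc n) * x" x] by (simp add: algebra_simps)
  with 3 show ?case
    by (cases "n = 0") (auto simp: cos_basis_def algebra_simps)
qed (auto simp: cos_basis_def)

text \<open>A gauge integral, because Cauchy's formula yields \<open>has_integral\<close>
  statements. It agrees with the Lebesgue integral of \<open>bs_inner\<close>, since the weight is a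
  multiple of the squared modulus of \<open>szego\<close> and thus continuous even where c has a
  pole.\<close>

definition bs_functional :: "bs_params \<Rightarrow> real poly \<Rightarrow> real" where
  "bs_functional P f = integral {0..pi} (\<lambda>\<xi>. poly f (2 * cos \<xi>) * bs_w P \<xi>)"

lemma continuous_on_poly_w:
  "bs_admissible P \<Longrightarrow> continuous_on S (\<lambda>\<xi>. poly f (2 * cos \<xi>) * bs_w P \<xi>)"
  by (intro continuous_intros continuous_on_bs_w)

lemma interval_integral_eq_bs_functional:
  assumes "bs_admissible P"
  shows "(LBINT \<xi>=0..pi. poly f (2 * cos \<xi>) * bs_w P \<xi>) = bs_functional P f"
  unfolding bs_functional_def zero_ereal_def
  by (intro interval_integral_eq_integral borel_integrable_atLeastAtMost' continuous_on_poly_w assms) simp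

lemma bs_inner_poly:
  "bs_admissible P \<Longrightarrow> bs_inner P (\<lambda>\<xi>. poly f (2 * cos \<xi>)) (\<lambda>\<xi>. poly g (2 * cos \<xi>)) = bs_functional P (f * g)"
  unfolding bs_inner_def by (simp flip: interval_integral_eq_bs_functional)

lemma infinite_cos_image: "infinite ((\<lambda>x. 2 * cos x) ` {0<..<pi})"
proof
  assume "finite ((\<lambda>x. 2 * cos x) ` {0<..<pi})"
  moreover have "inj_on (\<lambda>x. 2 * cos x) {0<..<pi}"
    using cos_inj_pi by (auto intro!: inj_onI)
  ultimately have "finite {0<..<pi}"
    by (rule finite_imageD)
  then show False
    using infinite_Ioo[of 0 pi] by simp
qed

lemma poly_eq_0_if_cos:
  assumes "\<And>x. 0 < x \<Longrightarrow> x < pi \<Longrightarrow> poly f (2 * cos x) = 0"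
  shows "f = (0 :: real poly)"
proof (rule ccontr)
  assume "f \<noteq> 0"
  then have "finite {y. poly f y = 0}"
    by (rule poly_roots_finite)
  moreover have "(\<lambda>x. 2 * cos x) ` {0<..<pi} \<subseteq> {y. poly f y = 0}"
    using assms by auto
  ultimately show False
    using infinite_cos_image finite_subset by blast
qed

text \<open>The integrand of \<open>f * f\<close> is continuous and nonnegative, so a zero integral
  makes it vanish on [0, pi]. The weight is positive in the interior, where 2 cos takes infinitely
  many values, hence \<open>f\<close> is 0.\<close>

lemma positive_functional_bs:
  assumes P: "bs_admissible P"
  shows "positive_functional (bs_functional P) cos_poly"
proof
  have int: "(\<lambda>\<xi>. poly f (2 * cos \<xi>) * bs_w P \<xi>) integrable_on {0..pi}" for f
    by (intro integrable_continuous_interval continuous_on_poly_w P)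
  show "bs_functional P (f + g) = bs_functional P f + bs_functional P g" for f g
    unfolding bs_functional_def using integral_add[OF int[of f] int[of g]]
    by (simp add: distrib_right)
  show "bs_functional P (smult c f) = c * bs_functional P f" for c f
    unfolding bs_functional_def by (simp add: mult.assoc)
  show "bs_functional P (f * f) > 0" if "f \<noteq> 0" for f
  proof -
    have nonneg: "poly (f * f) (2 * cos \<xi>) * bs_w P \<xi> \<ge> 0" for \<xi>
      by (simp add: bs_w_nonneg)
    have "bs_functional P (f * f) \<noteq> 0"
    proof
      assume "bs_functional P (f * f) = 0"
      then have "\<forall>\<xi>\<in>{0..pi}. poly (f * f) (2 * cos \<xi>) * bs_w P \<xi> = 0"
        unfolding bs_functional_def
        by (subst (asm) integral_eq_0_iff[OF continuous_on_poly_w[OF P] pi_gt_zero nonneg]) auto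
      then have "poly f (2 * cos \<xi>) = 0" if "0 < \<xi>" "\<xi> < pi" for \<xi>
        using that bs_w_pos[OF P, of \<xi>] by force
      then show False
        using poly_eq_0_if_cos that by blast
    qed
    moreover have "bs_functional P (f * f) \<ge> 0"
      unfolding bs_functional_def using nonneg by (intro integral_nonneg int) auto
    ultimately show ?thesis
      by simp
  qed
qed (use cos_poly_coeff in auto)

abbreviation bs_poly :: "bs_params \<Rightarrow> nat \<Rightarrow> real poly" where
  "bs_poly P \<equiv> positive_functional.B (bs_functional P) cos_poly"

lemma bs_p_poly:
  assumes P: "bs_admissible P"
  shows "bs_p P l = (\<lambda>\<xi>. poly (bs_poly P l) (2 * cos \<xi>))"
proof (induction l rule: less_induct)
  case (less l)
  have cos: "cos_basis l = (\<lambda>\<xi>. poly (cos_poly l) (2 * cos \<xi>))"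
    by (simp add: poly_cos_poly)
  have "bs_inner P (cos_basis l) (bs_p P k) = bs_functional P (cos_poly l * bs_poly P k)"
    and "bs_inner P (bs_p P k) (bs_p P k) = bs_functional P (bs_poly P k * bs_poly P k)" if "k < l" for k
    unfolding less.IH[OF that] cos by (simp_all add: bs_inner_poly[OF P])
  then show ?case
    by (subst bs_p.simps, subst positive_functional.B.simps[OF positive_functional_bs[OF P]])
      (auto simp: fun_eq_iff poly_sum poly_cos_poly less.IH intro!: sum.cong)
qed

lemma bs_Delta_functional:
  assumes P: "bs_admissible P"
  shows "bs_Delta P l = bs_functional P (bs_poly P l * bs_poly P l)"
  unfolding bs_Delta_def bs_p_poly[OF P]
  by (subst interval_integral_eq_bs_functional[OF P, symmetric]) (simp add: power2_eq_square)

section \<open>Plane waves as polynomials in the cosine\<close>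

lemma one_plus_minus_inverse:
  fixes z :: complex
  assumes "z \<noteq> 0"
  shows "x / (1 + 1 / z) = x * z / (1 + z)" and "x / (1 - 1 / z) = - (x * z) / (1 - z)"
    and "x / ((1 + 1 / z) * (1 - 1 / z)) = - (x * z\<^sup>2) / ((1 + z) * (1 - z))"
proof -
  have s: "1 + 1 / z = (1 + z) / z" "1 - 1 / z = (1 - z) / (- z)"
    using assms by (simp_all add: field_simps)
  show "x / (1 + 1 / z) = x * z / (1 + z)" "x / (1 - 1 / z) = - (x * z) / (1 - z)"
    "x / ((1 + 1 / z) * (1 - 1 / z)) = - (x * z\<^sup>2) / ((1 + z) * (1 - z))"
    unfolding s by (simp_all add: power2_eq_square)
qed

text \<open>The poles at z = -1 and z = 1 cancel between the two summands. These identities supply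
  the starting values n = 0 and n = 1 in \<open>laurent_base_nat\<close>.\<close>

lemma laurent_base_cases:
  fixes z :: complex
  assumes z: "z \<noteq> 0"
  shows "1 + z \<noteq> 0 \<Longrightarrow> 1 / (1 + 1 / z) + 1 / (1 + z) = 1"
    and "1 - z \<noteq> 0 \<Longrightarrow> 1 / (1 - 1 / z) + 1 / (1 - z) = 1"
    and "1 + z \<noteq> 0 \<Longrightarrow> 1 - z \<noteq> 0 \<Longrightarrow> 1 / ((1 + 1 / z) * (1 - 1 / z)) + 1 / ((1 + z) * (1 - z)) = 1"
    and "1 + z \<noteq> 0 \<Longrightarrow> z / (1 + 1 / z) + 1 / (z * (1 + z)) = z + 1 / z - 1"
    and "1 - z \<noteq> 0 \<Longrightarrow> z / (1 - 1 / z) + 1 / (z * (1 - z)) = z + 1 / z + 1"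
    and "1 + z \<noteq> 0 \<Longrightarrow> 1 - z \<noteq> 0 \<Longrightarrow>
      z / ((1 + 1 / z) * (1 - 1 / z)) + 1 / (z * ((1 + z) * (1 - z))) = z + 1 / z"
proof -
  have clear: "x / d + 1 / (z * d) = y + 1 / z" if "x * z + 1 = (y * z + 1) * d" "d \<noteq> 0" for x y d :: complex
    using that z by (simp add: divide_simps) algebra
  have clear': "x / d + 1 / d = 1" if "x + 1 = d" "d \<noteq> 0" for x d :: complex
    using that by (simp flip: add_divide_distrib)
  note s = one_plus_minus_inverse[OF z]
  show "1 + z \<noteq> 0 \<Longrightarrow> 1 / (1 + 1 / z) + 1 / (1 + z) = 1"
    unfolding s by (intro clear') auto
  show "1 - z \<noteq> 0 \<Longrightarrow> 1 / (1 - 1 / z) + 1 / (1 - z) = 1"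
    unfolding s by (intro clear') auto
  show "1 + z \<noteq> 0 \<Longrightarrow> 1 - z \<noteq> 0 \<Longrightarrow> 1 / ((1 + 1 / z) * (1 - 1 / z)) + 1 / ((1 + z) * (1 - z)) = 1"
    unfolding s by (rule clear', simp add: power2_eq_square algebra_simps, simp)
  show "z / (1 + 1 / z) + 1 / (z * (1 + z)) = z + 1 / z - 1" if "1 + z \<noteq> 0"
    using clear[of "z * z" "z - 1" "1 + z"] that unfolding s by (simp add: algebra_simps)
  show "z / (1 - 1 / z) + 1 / (z * (1 - z)) = z + 1 / z + 1" if "1 - z \<noteq> 0"
    using clear[of "- (z * z)" "z + 1" "1 - z"] that unfolding s by (simp add: algebra_simps)
  show "z / ((1 + 1 / z) * (1 - 1 / z)) + 1 / (z * ((1 + z) * (1 - z))) = z + 1 / z"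
    if "1 + z \<noteq> 0" "1 - z \<noteq> 0"
    unfolding s by (rule clear, simp add: power2_eq_square algebra_simps, use that in simp)
qed

text \<open>Both powers z^n and z^(-n) solve y_(n+2) = (z + 1/z) y_(n+1) - y_n with coefficients
  free of p and m, so the polynomials obey a Chebyshev recursion and only n = 0, 1 depend on the
  case.\<close>

lemma laurent_base_nat:
  fixes p m :: nat
  assumes pm: "p \<in> {0, 1}" "m \<in> {0, 1}"
  shows "\<exists>R::complex poly. degree R \<le> n \<and>
    (\<forall>z. z \<noteq> 0 \<longrightarrow> (1 + of_nat p * z) * (1 - of_nat m * z) \<noteq> 0 \<longrightarrow>
      poly R (z + 1 / z) =
        z ^ n / ((1 + of_nat p / z) * (1 - of_nat m / z)) + 1 / (z ^ n * ((1 + of_nat p * z) * (1 - of_nat m * z))))"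
proof (induction n rule: induct_nat_012)
  case 0
  consider "p = 0" "m = 0" | "p = 1" "m = 0" | "p = 0" "m = 1" | "p = 1" "m = 1"
    using pm by auto
  then show ?case
  proof cases
    case 1
    then show ?thesis
      by (intro exI[of _ "[:2:]"]) auto
  qed (intro exI[of _ "[:1:]"]; simp add: laurent_base_cases)+
next
  case 1
  consider "p = 0" "m = 0" | "p = 1" "m = 0" | "p = 0" "m = 1" | "p = 1" "m = 1"
    using pm by auto
  then show ?case
  proof cases
    case 1
    then show ?thesis
      by (intro exI[of _ "[:0, 1:]"]) auto
  next
    case 2
    then show ?thesis
      by (intro exI[of _ "[:-1, 1:]"]) (simp add: laurent_base_cases)
  next
    case 3
    then show ?thesis
      by (intro exI[of _ "[:1, 1:]"]) (simp add: laurent_base_cases)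
  next
    case 4
    then show ?thesis
      by (intro exI[of _ "[:0, 1:]"]) (simp add: laurent_base_cases)
  qed
next
  case (ge2 n)
  then obtain R0 R1 :: "complex poly" where R:
    "degree R0 \<le> n" "degree R1 \<le> Suc n"
    "\<And>z. z \<noteq> 0 \<Longrightarrow> (1 + of_nat p * z) * (1 - of_nat m * z) \<noteq> 0 \<Longrightarrow> poly R0 (z + 1 / z) =
        z ^ n / ((1 + of_nat p / z) * (1 - of_nat m / z)) + 1 / (z ^ n * ((1 + of_nat p * z) * (1 - of_nat m * z)))"
    "\<And>z. z \<noteq> 0 \<Longrightarrow> (1 + of_nat p * z) * (1 - of_nat m * z) \<noteq> 0 \<Longrightarrow> poly R1 (z + 1 / z) =
        z ^ Suc n / ((1 + of_nat p / z) * (1 - of_nat m / z)) + 1 / (z ^ Suc n * ((1 + of_nat p * z) * (1 - of_nat m * z)))"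
    by blast
  have alg: "(z + 1 / z) * (z ^ Suc n / a + 1 / (z ^ Suc n * b)) - (z ^ n / a + 1 / (z ^ n * b)) =
      z ^ Suc (Suc n) / a + 1 / (z ^ Suc (Suc n) * b)" if "z \<noteq> 0" for a b z :: complex
  proof -
    have "(z + 1 / z) * z ^ Suc n = z ^ Suc (Suc n) + z ^ n"
      using that by (simp add: field_simps)
    moreover have "(z + 1 / z) * (1 / z ^ Suc n) = 1 / z ^ n + 1 / z ^ Suc (Suc n)"
      using that by (simp add: field_simps)
    moreover have "1 / (y * b) = 1 / y * inverse b" "y / a = y * inverse a" for y
      by (simp_all add: field_simps)
    ultimately show ?thesis
      by (simp only: distrib_left mult.assoc[symmetric]) (simp only: distrib_right, simp)
  qed
  have "degree ([:0, 1:] * R1 - R0) \<le> Suc (Suc n)"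
    using R(1,2) by (intro degree_diff_le) (auto intro: order.trans[OF degree_pCons_le])
  moreover have "poly ([:0, 1:] * R1 - R0) (z + 1 / z) =
        z ^ Suc (Suc n) / ((1 + of_nat p / z) * (1 - of_nat m / z)) +
        1 / (z ^ Suc (Suc n) * ((1 + of_nat p * z) * (1 - of_nat m * z)))"
    if "z \<noteq> 0" "(1 + of_nat p * z) * (1 - of_nat m * z) \<noteq> 0" for z
    unfolding alg[OF that(1), symmetric] R(3,4)[OF that, symmetric] by simp
  ultimately show ?case
    by blast
qed

text \<open>The symmetry of the Laurent expression under \<open>l \<mapsto> - l - p - m\<close>, up to the sign
  \<open>(- 1) ^ m\<close>, reduces negative \<open>l\<close> to nonnegative ones; the only fixed case \<open>l = - 1\<close>,
  \<open>p = m = 1\<close> gives the zero polynomial.\<close>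

lemma laurent_base:
  fixes p m :: nat and l :: int
  assumes pm: "p \<in> {0, 1}" "m \<in> {0, 1}" and l: "l \<le> int N" "- l - int p - int m \<le> int N"
  shows "\<exists>R::complex poly. degree R \<le> N \<and>
    (\<forall>z. z \<noteq> 0 \<longrightarrow> (1 + of_nat p * z) * (1 - of_nat m * z) \<noteq> 0 \<longrightarrow>
      poly R (z + 1 / z) =
        z powi l / ((1 + of_nat p / z) * (1 - of_nat m / z)) +
        z powi (- l) / ((1 + of_nat p * z) * (1 - of_nat m * z)))"
proof -
  let ?G = "\<lambda>l z. z powi l / ((1 + of_nat p / z) * (1 - of_nat m / z)) +
        z powi (- l) / ((1 + of_nat p * z) * (1 - of_nat m * z :: complex))"
  \<comment> \<open>From 1 + 1/z = (1 + z)/z and 1 - 1/z = -(1 - z)/z: each factor that is present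
    shifts the exponent by one, and the second one also contributes a sign.\<close>
  have flip: "?G (- l - int p - int m) z = (- 1) ^ m * ?G l z"
    if "z \<noteq> 0" "(1 + of_nat p * z) * (1 - of_nat m * z) \<noteq> 0" for l z
  proof -
    note s = one_plus_minus_inverse[OF that(1)]
    define y where "y = z powi l"
    have y: "y \<noteq> 0" "z powi (- l) = 1 / y" "z powi (- l - int k) = 1 / (y * z ^ k)" "z powi (l + int k) = y * z ^ k" for k
      using that(1) by (simp_all add: y_def power_int_add power_int_diff power_int_minus divide_inverse)
    have y': "z powi (- l - int k - int j) = 1 / (y * z ^ (k + j))" "z powi (- (- l - int k - int j)) = y * z ^ (k + j)" for k j
      using y(3)[of "k + j"] y(4)[of "k + j"] by (simp_all add: algebra_simps)
    consider "p = 0" "m = 0" | "p = 1" "m = 0" | "p = 0" "m = 1" | "p = 1" "m = 1"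
      using pm by auto
    then show ?thesis
    proof cases
      case 1
      then show ?thesis by simp
    next
      case 2
      then show ?thesis
        unfolding y' y(2) y_def[symmetric] using y(1) that(1) by (simp add: s)
    next
      case 3
      then show ?thesis
        unfolding y' y(2) y_def[symmetric] using y(1) that(1) by (simp add: s)
    next
      case 4
      then show ?thesis
        unfolding y' y(2) y_def[symmetric] using y(1) that(1) by (simp add: s power2_eq_square)
    qed
  qed
  have nat: "\<exists>R::complex poly. degree R \<le> N \<and>
    (\<forall>z. z \<noteq> 0 \<longrightarrow> (1 + of_nat p * z) * (1 - of_nat m * z) \<noteq> 0 \<longrightarrow> poly R (z + 1 / z) = ?G (int n) z)"
    if "n \<le> N" for n
    using laurent_base_nat[OF pm, of n] that
    by (simp add: power_int_minus divide_inverse) (meson order.trans)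
  \<comment> \<open>If l and its mirror image are both negative, then 0 < -l < p + m \<le> 2, which
    leaves only l = -1 and p = m = 1.\<close>
  consider "l \<ge> 0" | "l < 0" "- l - int p - int m \<ge> 0" | "l = -1" "p = 1" "m = 1"
    using pm by fastforce
  then show ?thesis
  proof cases
    case 1
    then show ?thesis
      using nat[of "nat l"] l by simp
  next
    case 2
    define n where "n = nat (- l - int p - int m)"
    with 2 l have n: "int n = - l - int p - int m" "n \<le> N"
      by auto
    then obtain R where R: "degree R \<le> N" "\<And>z. z \<noteq> 0 \<Longrightarrow> (1 + of_nat p * z) * (1 - of_nat m * z) \<noteq> 0 \<Longrightarrow>
        poly R (z + 1 / z) = ?G (- l - int p - int m) z"
      using nat[of n] unfolding n(1) by blast
    have "poly (smult ((- 1) ^ m) R) (z + 1 / z) = ?G l z"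
      if "z \<noteq> 0" "(1 + of_nat p * z) * (1 - of_nat m * z) \<noteq> 0" for z
      unfolding poly_smult R(2)[OF that] flip[OF that] by (simp flip: power_add mult.assoc)
    moreover have "degree (smult ((- 1) ^ m) R) \<le> N"
      using R(1) by simp
    ultimately show ?thesis
      by blast
  next
    case 3
    have e: "- l - int p - int m = l"
      using 3 by simp
    have odd: "x = 0" if "x = (- 1) ^ m * x" for x :: complex
      using that 3 by simp
    have "?G l z = 0" if "z \<noteq> 0" "(1 + of_nat p * z) * (1 - of_nat m * z) \<noteq> 0" for z
      using flip[OF that, of l, unfolded e] by (rule odd)
    then show ?thesis
      by (intro exI[of _ 0]) auto
  qed
qed

text \<open>The factor with parameter \<alpha> splits the expression at l into the shorter one at l
  plus \<alpha> times the shorter one at l - 1, and both bounds survive this. For l = N the second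
  bound reads 2 \<open>d_eps\<close> \<le> 2 N, which is the origin of the threshold
  \<open>d_eps\<close>.\<close>

lemma laurent_poly:
  fixes p m :: nat and l :: int
  assumes pm: "p \<in> {0, 1}" "m \<in> {0, 1}"
    and l: "l \<le> int N" "int (length as) - l - int p - int m \<le> int N"
  shows "\<exists>R::complex poly. degree R \<le> N \<and>
    (\<forall>z. z \<noteq> 0 \<longrightarrow> (1 + of_nat p * z) * (1 - of_nat m * z) \<noteq> 0 \<longrightarrow>
      poly R (z + 1 / z) =
        (\<Prod>\<alpha>\<leftarrow>as. 1 + \<alpha> / z) * z powi l / ((1 + of_nat p / z) * (1 - of_nat m / z)) +
        (\<Prod>\<alpha>\<leftarrow>as. 1 + \<alpha> * z) * z powi (- l) / ((1 + of_nat p * z) * (1 - of_nat m * z)))"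
  using l
proof (induction as arbitrary: l)
  case Nil
  then show ?case
    using laurent_base[OF pm, of l N] by simp
next
  case (Cons \<alpha> as)
  have "l - 1 \<le> int N" "int (length as) - (l - 1) - int p - int m \<le> int N"
    "int (length as) - l - int p - int m \<le> int N"
    using Cons.prems by auto
  with Cons obtain R0 R1 :: "complex poly" where R:
    "degree R0 \<le> N" "degree R1 \<le> N"
    "\<And>z. z \<noteq> 0 \<Longrightarrow> (1 + of_nat p * z) * (1 - of_nat m * z) \<noteq> 0 \<Longrightarrow> poly R0 (z + 1 / z) =
        (\<Prod>\<alpha>\<leftarrow>as. 1 + \<alpha> / z) * z powi l / ((1 + of_nat p / z) * (1 - of_nat m / z)) +
        (\<Prod>\<alpha>\<leftarrow>as. 1 + \<alpha> * z) * z powi (- l) / ((1 + of_nat p * z) * (1 - of_nat m * z))"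
    "\<And>z. z \<noteq> 0 \<Longrightarrow> (1 + of_nat p * z) * (1 - of_nat m * z) \<noteq> 0 \<Longrightarrow> poly R1 (z + 1 / z) =
        (\<Prod>\<alpha>\<leftarrow>as. 1 + \<alpha> / z) * z powi (l - 1) / ((1 + of_nat p / z) * (1 - of_nat m / z)) +
        (\<Prod>\<alpha>\<leftarrow>as. 1 + \<alpha> * z) * z powi (- (l - 1)) / ((1 + of_nat p * z) * (1 - of_nat m * z))"
    by metis
  have "degree (R0 + smult \<alpha> R1) \<le> N"
    using R(1,2) by (intro degree_add_le) auto
  moreover have "poly (R0 + smult \<alpha> R1) (z + 1 / z) =
        (\<Prod>\<alpha>\<leftarrow>\<alpha> # as. 1 + \<alpha> / z) * z powi l / ((1 + of_nat p / z) * (1 - of_nat m / z)) +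
        (\<Prod>\<alpha>\<leftarrow>\<alpha> # as. 1 + \<alpha> * z) * z powi (- l) / ((1 + of_nat p * z) * (1 - of_nat m * z))"
    if "z \<noteq> 0" "(1 + of_nat p * z) * (1 - of_nat m * z) \<noteq> 0" for z
  proof -
    have "z powi (l - 1) = z powi l / z" "z powi (- (l - 1)) = z powi (- l) * z"
      using that(1) power_int_diff[of z l 1] power_int_add[of z "- l" 1] by simp_all
    then show ?thesis
      by (simp add: R(3,4)[OF that] add_divide_distrib algebra_simps)
  qed
  ultimately show ?case
    by blast
qed

lemma bs_q_poly:
  assumes P: "bs_admissible P" and l: "d_eps P \<le> real l"
  shows "\<exists>R::real poly. degree R \<le> l \<and>
    (\<forall>\<xi>. szego P (cis \<xi>) \<noteq> 0 \<longrightarrow>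
      complex_of_real (poly R (2 * cos \<xi>)) = bs_c P \<xi> * cis (real l * \<xi>) + bs_c P (- \<xi>) * cis (- (real l * \<xi>)))"
proof -
  have pm: "eps_plus P \<in> {0, 1}" "eps_minus P \<in> {0, 1}"
    using P by (auto simp: bs_admissible_def)
  have "int (length (alphas P)) - int l - int (eps_plus P) - int (eps_minus P) \<le> int l"
    using l by (simp add: d_eps_def)
  from laurent_poly[OF pm order.refl this]
  obtain R :: "complex poly" where R: "degree R \<le> l" 
    "\<And>z. z \<noteq> 0 \<Longrightarrow> (1 + of_nat (eps_plus P) * z) * (1 - of_nat (eps_minus P) * z) \<noteq> 0 \<Longrightarrow> poly R (z + 1 / z) =
        (\<Prod>\<alpha>\<leftarrow>alphas P. 1 + \<alpha> / z) * z powi int l / ((1 + of_nat (eps_plus P) / z) * (1 - of_nat (eps_minus P) / z)) +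
        (\<Prod>\<alpha>\<leftarrow>alphas P. 1 + \<alpha> * z) * z powi (- int l) / ((1 + of_nat (eps_plus P) * z) * (1 - of_nat (eps_minus P) * z))"
    by blast
  \<comment> \<open>Taking real parts of the coefficients preserves the values at 2 cos \<xi>, which
    are real because the two plane-wave terms are conjugate.\<close>
  define R' where "R' = map_poly Re R"
  have R': "poly R' x = Re (poly R (complex_of_real x))" for x
    unfolding R'_def by (induction R) (auto simp: map_poly_pCons)
  have "complex_of_real (poly R' (2 * cos \<xi>)) = bs_c P \<xi> * cis (real l * \<xi>) + bs_c P (- \<xi>) * cis (- (real l * \<xi>))"
    if reg: "szego P (cis \<xi>) \<noteq> 0" for \<xi>
  proof -
    let ?z = "cis \<xi>"
    have z: "1 / ?z = cis (- \<xi>)" "?z powi int l = cis (real l * \<xi>)" "?z powi (- int l) = cis (- (real l * \<xi>))"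
      by (metis cis_inverse inverse_eq_divide) (simp_all add: Complex.DeMoivre power_int_minus)
    have "poly R (?z + 1 / ?z) = bs_c P \<xi> * cis (real l * \<xi>) + bs_c P (- \<xi>) * cis (- (real l * \<xi>))"
      using reg unfolding z(1)
      by (subst R(2)[of ?z, unfolded z])
        (simp_all add: szego_def bs_c_szego flip: cis_inverse, simp_all add: field_simps)
    moreover have "?z + 1 / ?z = complex_of_real (2 * cos \<xi>)"
      unfolding z(1) by (simp add: complex_eq_iff)
    ultimately have eq: "poly R (complex_of_real (2 * cos \<xi>)) = bs_c P \<xi> * cis (real l * \<xi>) + bs_c P (- \<xi>) * cis (- (real l * \<xi>))"
      by simp
    have "bs_c P (- \<xi>) = cnj (bs_c P \<xi>)"
      using szego_cnj[OF P, of "cis (- \<xi>)"] by (simp add: bs_c_szego cis_cnj)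
    then have "cnj (poly R (complex_of_real (2 * cos \<xi>))) = poly R (complex_of_real (2 * cos \<xi>))"
      unfolding eq by (simp add: cis_cnj)
    then have "complex_of_real (Re (poly R (complex_of_real (2 * cos \<xi>)))) = poly R (complex_of_real (2 * cos \<xi>))"
      by (metis Reals_cnj_iff complex_is_Real_iff of_real_Re)
    then show ?thesis
      unfolding R' by (rule trans[OF _ eq])
  qed
  moreover have "degree R' \<le> l"
    using R(1) unfolding R'_def by (intro degree_le) (auto simp: coeff_map_poly coeff_eq_0)
  ultimately show ?thesis
    by blast
qed

section \<open>Explicit form and recurrence\<close>

lemma bs_functional_cos_poly_mult:
  assumes P: "bs_admissible P" and "k \<le> l"
    and R: "\<And>\<xi>. szego P (cis \<xi>) \<noteq> 0 \<Longrightarrow> complex_of_real (poly R (2 * cos \<xi>)) =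
      bs_c P \<xi> * cis (real l * \<xi>) + bs_c P (- \<xi>) * cis (- (real l * \<xi>))"
  shows "bs_functional P (cos_poly k * R) = of_bool (k = l)"
proof -
  \<comment> \<open>The weight cancels one factor of c and turns R into the real part of
    \<open>szego\<close> times z^l, up to 1/pi; multiplying by 2 cos (k \<xi>) splits z^l into z^(l
    + k) + z^(l - k). Since k \<le> l, no negative power appears, and \<open>h 0\<close> is nonzero
    only for k = l.\<close>
  define h where "h z = szego P z * (if k = 0 then z ^ l else z ^ (l + k) + z ^ (l - k))" for z
  have hol: "h holomorphic_on cball 0 1"
    unfolding h_def using szego_holomorphic[OF P] by (cases "k = 0") (auto intro!: holomorphic_intros)
  have "((\<lambda>t. Re (h (cis t))) has_integral pi * Re (h 0)) {0..pi}"
  proof (rule has_integral_Re_circle)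
    show "continuous_on (cball 0 1) h"
      using hol by (rule holomorphic_on_imp_continuous_on)
    show "h holomorphic_on ball 0 1"
      using hol by (rule holomorphic_on_subset) auto
    show "h (cnj z) = cnj (h z)" for z
      by (simp add: h_def szego_cnj[OF P])
  qed
  moreover have "Re (h 0) = of_bool (k = l)"
    using \<open>k \<le> l\<close> by (auto simp: h_def szego_0 power_0_left)
  ultimately have "((\<lambda>t. Re (h (cis t))) has_integral pi * of_bool (k = l)) {0..pi}"
    by simp
  from has_integral_mult_right[OF this, of "1 / pi"]
  have int: "((\<lambda>t. 1 / pi * Re (h (cis t))) has_integral of_bool (k = l)) {0..pi}"
    by simp
  have "poly (cos_poly k * R) (2 * cos \<xi>) * bs_w P \<xi> = 1 / pi * Re (h (cis \<xi>))"
    if "\<xi> \<in> {0..pi} - {0, pi}" for \<xi>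
  proof -
    have "szego P (cis \<xi>) \<noteq> 0"
      using that by (intro szego_nonzero_interior P) auto
    moreover define s where "s = szego P (cis \<xi>)"
    moreover have "szego P (cis (- \<xi>)) = cnj s"
      using szego_cnj[OF P, of "cis \<xi>"] by (simp add: s_def cis_cnj)
    ultimately have s: "s \<noteq> 0" "bs_c P \<xi> = inverse (cnj s)" "bs_c P (- \<xi>) = inverse s"
      "bs_w P \<xi> = (cmod s)\<^sup>2 / (2 * pi)"
      by (simp_all add: bs_c_szego bs_w_szego)
    have "complex_of_real (poly R (2 * cos \<xi>)) * complex_of_real ((cmod s)\<^sup>2) =
        (inverse (cnj s) * cis (real l * \<xi>) + inverse s * cis (- (real l * \<xi>))) * (s * cnj s)"
      unfolding complex_norm_square using R[of \<xi>] s by (simp add: s_def)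
    also have "\<dots> = s * cis (real l * \<xi>) + cnj (s * cis (real l * \<xi>))"
      using s(1) by (simp add: cis_cnj field_simps)
    also have "\<dots> = complex_of_real (2 * Re (s * cis (real l * \<xi>)))"
      by (rule complex_add_cnj)
    finally have "poly R (2 * cos \<xi>) * (cmod s)\<^sup>2 = 2 * Re (s * cis (real l * \<xi>))"
      by (metis of_real_eq_iff of_real_mult)
    then have "poly R (2 * cos \<xi>) * bs_w P \<xi> = 1 / pi * Re (s * cis (real l * \<xi>))"
      by (simp add: s(4) field_simps)
    moreover have "h (cis \<xi>) = complex_of_real (cos_basis k \<xi>) * (s * cis (real l * \<xi>))"
    proof (cases "k = 0")
      case True
      then show ?thesis
        by (simp add: h_def s_def cos_basis_def Complex.DeMoivre)
    next
      case False
      have "cis \<xi> ^ (l + k) + cis \<xi> ^ (l - k) = complex_of_real (2 * cos (real k * \<xi>)) * cis (real l * \<xi>)"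
        using \<open>k \<le> l\<close> by (simp add: Complex.DeMoivre complex_eq_iff of_nat_diff algebra_simps cos_add cos_diff sin_add sin_diff)
      with False show ?thesis
        by (simp add: h_def s_def cos_basis_def)
    qed
    ultimately show ?thesis
      by (simp add: poly_cos_poly mult.assoc)
  qed
  then have "((\<lambda>\<xi>. poly (cos_poly k * R) (2 * cos \<xi>) * bs_w P \<xi>) has_integral of_bool (k = l)) {0..pi}"
    \<comment> \<open>The end points are left out because c may have poles there.\<close>
    by (intro has_integral_spike_finite[OF _ _ int, of "{0, pi}"]) auto
  then show ?thesis
    unfolding bs_functional_def by (rule integral_unique)
qed

lemma bs_pn_poly:
  assumes P: "bs_admissible P"
  shows "bs_pn P l \<xi> = poly (smult (1 / bs_Delta P l) (bs_poly P l)) (2 * cos \<xi>)"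
  by (simp add: bs_pn_def bs_p_poly[OF P])

lemma bs_pn_explicit:
  assumes P: "bs_admissible P" and l: "d_eps P \<le> real l" and reg: "szego P (cis \<xi>) \<noteq> 0"
  shows "complex_of_real (bs_pn P l \<xi>) = bs_c P \<xi> * cis (real l * \<xi>) + bs_c P (- \<xi>) * cis (- (real l * \<xi>))"
proof -
  obtain R :: "real poly" where R: "degree R \<le> l"
    "\<And>\<xi>. szego P (cis \<xi>) \<noteq> 0 \<Longrightarrow> complex_of_real (poly R (2 * cos \<xi>)) =
      bs_c P \<xi> * cis (real l * \<xi>) + bs_c P (- \<xi>) * cis (- (real l * \<xi>))"
    using bs_q_poly[OF P l] by blast
  have "R = smult (1 / bs_Delta P l) (bs_poly P l)"
    unfolding bs_Delta_functional[OF P]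
  proof (rule positive_functional.eq_normalized_B[OF positive_functional_bs[OF P]])
    show "coeff R i = 0" if "i > l" for i
      using that R(1) by (intro coeff_eq_0) simp
    show "bs_functional P (cos_poly k * R) = 0" if "k < l" for k
      using bs_functional_cos_poly_mult[OF P _ R(2), of k] that by simp
    show "bs_functional P (cos_poly l * R) = 1"
      using bs_functional_cos_poly_mult[OF P _ R(2), of l] by simp
  qed
  then show ?thesis
    using R(2)[OF reg] by (simp add: bs_pn_poly[OF P])
qed

lemma bs_Delta_pos: "bs_admissible P \<Longrightarrow> bs_Delta P l > 0"
  by (simp add: bs_Delta_functional positive_functional.norm_pos[OF positive_functional_bs])

text \<open>Division of the monic recurrence by \<open>bs_Delta P l\<close> moves the norm ratio
  from the lower neighbour to the upper one. As \<open>bs_b\<close> is a definite description,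
  \<beta> must also be unique: \<open>B l\<close> is nonzero at some 2 cos x.\<close>

lemma bs_pn_recurrence:
  assumes P: "bs_admissible P"
  shows "2 * cos \<xi> * bs_pn P l \<xi> = (if l = 0 then 0 else bs_pn P (l - 1) \<xi>) +
     bs_b P l * bs_pn P l \<xi> + (bs_a P (l + 1))\<^sup>2 * bs_pn P (l + 1) \<xi>"
proof -
  interpret positive_functional "bs_functional P" cos_poly
    by (rule positive_functional_bs[OF P])
  define rec where "rec b \<longleftrightarrow> (\<forall>\<xi>. 2 * cos \<xi> * bs_pn P l \<xi> = (if l = 0 then 0 else bs_pn P (l - 1) \<xi>) +
     b * bs_pn P l \<xi> + (bs_a P (l + 1))\<^sup>2 * bs_pn P (l + 1) \<xi>)" for b
  have D: "bs_Delta P k \<noteq> 0" for k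
    using bs_Delta_pos[OF P, of k] by simp
  obtain \<beta> where \<beta>: "[:0, 1:] * B l =
     (if l = 0 then 0 else smult (bs_Delta P l / bs_Delta P (l - 1)) (B (l - 1))) + smult \<beta> (B l) + B (Suc l)"
    using three_term_recurrence[of l] unfolding bs_Delta_functional[OF P] by blast
  have a: "(bs_a P (l + 1))\<^sup>2 = bs_Delta P (l + 1) / bs_Delta P l"
    using bs_Delta_pos[OF P, of l] bs_Delta_pos[OF P, of "Suc l"] by (simp add: bs_a_def)
  have "rec \<beta>"
    unfolding rec_def
  proof
    fix x
    have "2 * cos x * poly (B l) (2 * cos x) =
       (if l = 0 then 0 else bs_Delta P l / bs_Delta P (l - 1) * poly (B (l - 1)) (2 * cos x)) +
       \<beta> * poly (B l) (2 * cos x) + poly (B (Suc l)) (2 * cos x)"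
      using arg_cong[OF \<beta>, of "\<lambda>p. poly p (2 * cos x)"] by (cases "l = 0") auto
    then show "2 * cos x * bs_pn P l x = (if l = 0 then 0 else bs_pn P (l - 1) x) +
       \<beta> * bs_pn P l x + (bs_a P (l + 1))\<^sup>2 * bs_pn P (l + 1) x"
      unfolding a using D[of l] D[of "Suc l"] D[of "l - 1"]
      by (cases "l = 0") (simp_all add: bs_pn_poly[OF P] field_simps)
  qed
  moreover have "b = \<beta>" if "rec b" for b
  proof -
    obtain x where "poly (B l) (2 * cos x) \<noteq> 0"
      using poly_eq_0_if_cos[of "B l"] B_nonzero by blast
    then have "bs_pn P l x \<noteq> 0"
      using D[of l] by (simp add: bs_pn_poly[OF P])
    moreover have "b * bs_pn P l x = \<beta> * bs_pn P l x"
      using that \<open>rec \<beta>\<close> unfolding rec_def by (metis add_left_cancel add_right_cancel)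
    ultimately show ?thesis
      by simp
  qed
  ultimately have "rec (THE b. rec b)"
    by (rule theI)
  then have "rec (bs_b P l)"
    unfolding bs_b_def rec_def .
  then show ?thesis
    by (simp add: rec_def)
qed

section \<open>Nodes\<close>

text \<open>An antiderivative of \<open>bs_u \<alpha>\<close>, from the partial fraction decomposition
  \<open>u\<^sub>\<alpha>(x) = 1 / (1 + \<alpha> exp (i x)) + 1 / (1 + \<alpha> exp (- i x)) - 1\<close>.\<close>

definition bs_phase :: "complex \<Rightarrow> complex \<Rightarrow> complex" where
  "bs_phase \<alpha> w = w + \<i> * (Ln (1 + \<alpha> * exp (\<i> * w)) - Ln (1 + \<alpha> * exp (- \<i> * w)))"

text \<open>Keeps the arguments of both logarithms in \<open>bs_phase\<close> away from the branch
  cut, so that \<open>Ln\<close> is differentiable there and commutes with conjugation.\<close>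

lemma one_plus_right_halfplane:
  assumes "cmod \<alpha> < 1"
  shows "Re (1 + \<alpha> * cis x) > 0"
proof -
  have "\<bar>Re (\<alpha> * cis x)\<bar> \<le> cmod (\<alpha> * cis x)"
    by (rule abs_Re_le_cmod)
  also have "\<dots> < 1"
    using assms by (simp add: norm_mult)
  finally have "\<bar>Re (\<alpha> * cis x)\<bar> < 1" .
  then show ?thesis
    unfolding plus_complex.sel one_complex.sel by linarith
qed

lemma one_plus_not_nonpos: "cmod \<alpha> < 1 \<Longrightarrow> 1 + \<alpha> * cis x \<notin> \<real>\<^sub>\<le>\<^sub>0"
  using one_plus_right_halfplane[of \<alpha> x] by (auto simp: complex_nonpos_Reals_iff)

lemma one_plus_nonzero: "cmod \<alpha> < 1 \<Longrightarrow> 1 + \<alpha> * cis x \<noteq> 0"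
  using one_plus_not_nonpos[of \<alpha> x] by auto

lemma bs_phase_real:
  "bs_phase \<alpha> (complex_of_real x) = of_real x + \<i> * (Ln (1 + \<alpha> * cis x) - Ln (1 + \<alpha> * cis (- x)))"
  by (simp add: bs_phase_def cis_conv_exp)

lemma bs_u_partial_fractions:
  assumes "cmod \<alpha> < 1"
  shows "bs_u \<alpha> x = 1 / (1 + \<alpha> * cis x) + 1 / (1 + \<alpha> * cis (- x)) - 1"
    and "1 + 2 * \<alpha> * of_real (cos x) + \<alpha>\<^sup>2 \<noteq> 0"
proof -
  have z: "cis x * cis (- x) = 1" "2 * of_real (cos x) = cis x + cis (- x)"
    by (simp_all add: cis_mult complex_eq_iff)
  have den: "1 + 2 * \<alpha> * of_real (cos x) + \<alpha>\<^sup>2 = (1 + \<alpha> * cis x) * (1 + \<alpha> * cis (- x))"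
  proof -
    have "(1 + \<alpha> * cis x) * (1 + \<alpha> * cis (- x)) = 1 + \<alpha> * (cis x + cis (- x)) + \<alpha>\<^sup>2 * (cis x * cis (- x))"
      by (simp only: power2_eq_square ring_distribs mult_1_left mult_1_right mult_ac add_ac)
    then show ?thesis
      unfolding z(1) z(2)[symmetric] by (simp add: mult_ac)
  qed
  have nz: "1 + \<alpha> * cis x \<noteq> 0" "1 + \<alpha> * cis (- x) \<noteq> 0"
    using assms one_plus_nonzero by blast+
  show "1 + 2 * \<alpha> * of_real (cos x) + \<alpha>\<^sup>2 \<noteq> 0"
    unfolding den using nz by simp
  have "1 / a + 1 / b - 1 = (a + b - a * b) / (a * b)" if "a \<noteq> 0" "b \<noteq> 0" for a b :: complex
    using that by (simp add: field_simps)
  moreover have "1 - \<alpha>\<^sup>2 = (1 + \<alpha> * cis x) + (1 + \<alpha> * cis (- x)) - (1 + \<alpha> * cis x) * (1 + \<alpha> * cis (- x))"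
  proof -
    have "1 + u + (1 + v) - (1 + u) * (1 + v) = 1 - u * v" for u v :: complex
      by (simp add: algebra_simps)
    moreover have "\<alpha> * cis x * (\<alpha> * cis (- x)) = \<alpha>\<^sup>2 * (cis x * cis (- x))"
      by (simp only: power2_eq_square mult_ac)
    ultimately show ?thesis
      unfolding z(1) by simp
  qed
  ultimately show "bs_u \<alpha> x = 1 / (1 + \<alpha> * cis x) + 1 / (1 + \<alpha> * cis (- x)) - 1"
    unfolding bs_u_def den using nz by simp
qed

lemma bs_phase_deriv:
  assumes "cmod \<alpha> < 1"
  shows "((\<lambda>x. bs_phase \<alpha> (of_real x)) has_vector_derivative bs_u \<alpha> x) (at x within S)"
proof (rule has_vector_derivative_real_field)
  have nn: "1 + \<alpha> * exp (\<i> * complex_of_real x) \<notin> \<real>\<^sub>\<le>\<^sub>0" "1 + \<alpha> * exp (- \<i> * complex_of_real x) \<notin> \<real>\<^sub>\<le>\<^sub>0"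
    using one_plus_not_nonpos[OF assms, of x] one_plus_not_nonpos[OF assms, of "- x"]
    by (simp_all add: cis_conv_exp)
  have nz: "1 + \<alpha> * cis x \<noteq> 0" "1 + \<alpha> * cis (- x) \<noteq> 0"
    using assms one_plus_nonzero by blast+
  have u: "1 + \<i> * (\<alpha> * (\<i> * cis x) / (1 + \<alpha> * cis x) - \<alpha> * (- \<i> * cis (- x)) / (1 + \<alpha> * cis (- x))) = bs_u \<alpha> x"
  proof -
    have "\<alpha> * (\<i> * cis x) / (1 + \<alpha> * cis x) = \<i> * (1 - 1 / (1 + \<alpha> * cis x))"
      "\<alpha> * (- \<i> * cis (- x)) / (1 + \<alpha> * cis (- x)) = - \<i> * (1 - 1 / (1 + \<alpha> * cis (- x)))"
      using nz by (simp_all add: divide_simps)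
    moreover have "1 + \<i> * (\<i> * (1 - a) - - \<i> * (1 - b)) = a + b - 1" for a b
      by (simp add: algebra_simps)
    ultimately show ?thesis
      unfolding bs_u_partial_fractions(1)[OF assms] by (simp only:)
  qed
  have "(bs_phase \<alpha> has_field_derivative
      1 + \<i> * (\<alpha> * (\<i> * exp (\<i> * of_real x)) / (1 + \<alpha> * exp (\<i> * of_real x)) -
        \<alpha> * (- \<i> * exp (- \<i> * of_real x)) / (1 + \<alpha> * exp (- \<i> * of_real x)))) (at (of_real x))"
    unfolding bs_phase_def[abs_def] using nn
    by (auto intro!: derivative_eq_intros simp: divide_inverse algebra_simps)
  then show "(bs_phase \<alpha> has_field_derivative bs_u \<alpha> x) (at (of_real x))"
    unfolding u[symmetric] by (simp add: cis_conv_exp)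
qed

lemma integral_bs_u:
  assumes "cmod \<alpha> < 1"
  shows "(LBINT x=0..\<xi>. bs_u \<alpha> x) = bs_phase \<alpha> (of_real \<xi>)"
proof -
  have "continuous_on S (bs_u \<alpha>)" for S
    unfolding bs_u_def[abs_def] by (intro continuous_intros) (use bs_u_partial_fractions(2)[OF assms] in auto)
  then have "(LBINT x=ereal 0..\<xi>. bs_u \<alpha> x) = bs_phase \<alpha> (of_real \<xi>) - bs_phase \<alpha> (of_real 0)"
    by (rule interval_integral_FTC_finite[OF _ bs_phase_deriv[OF assms]])
  then show ?thesis
    by (simp add: zero_ereal_def bs_phase_def)
qed

text \<open>The two logarithms coincide at pi and cancel, so each parameter contributes exactly pi
  to the node equation at the right end point.\<close>

lemma bs_phase_pi: "bs_phase \<alpha> (of_real pi) = of_real pi"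
proof -
  have "cis (- pi) = cis pi"
    by (simp add: complex_eq_iff)
  then show ?thesis
    unfolding bs_phase_real by simp
qed

lemma cnj_bs_phase:
  assumes "cmod \<alpha> < 1"
  shows "cnj (bs_phase \<alpha> (of_real x)) = bs_phase (cnj \<alpha>) (of_real x)"
  unfolding bs_phase_real using one_plus_not_nonpos[OF assms]
  by (simp add: cnj_Ln cis_cnj algebra_simps)

text \<open>The Moebius map w -> 1 / (1 + w) takes the unit disc to the half-plane Re > 1/2. Two
  such terms minus 1 give \<open>bs_u\<close> a positive real part, for nonreal parameters as
  well.\<close>

lemma Re_inverse_gt_half:
  assumes "cmod w < 1"
  shows "Re (1 / (1 + w)) > 1 / 2"
proof -
  have "(cmod w)\<^sup>2 < 1"
    using assms by (simp add: abs_square_less_1)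
  then have w: "(Re w)\<^sup>2 + (Im w)\<^sup>2 < 1"
    by (simp add: cmod_power2)
  then have "(1 + Re w)\<^sup>2 + (Im w)\<^sup>2 < 2 * (1 + Re w)"
    by (simp add: power2_eq_square algebra_simps)
  moreover have "(1 + Re w)\<^sup>2 + (Im w)\<^sup>2 > 0"
  proof -
    have "(Re w)\<^sup>2 < 1"
      using w zero_le_power2[of "Im w"] by linarith
    then have "1 + Re w \<noteq> 0"
      by (auto simp: add_eq_0_iff)
    then show ?thesis
      by (simp add: sum_power2_gt_zero_iff)
  qed
  ultimately show ?thesis
    by (simp add: Re_divide field_simps)
qed

lemma Re_bs_u_pos:
  assumes "cmod \<alpha> < 1"
  shows "Re (bs_u \<alpha> x) > 0"
  using Re_inverse_gt_half[of "\<alpha> * cis x"] Re_inverse_gt_half[of "\<alpha> * cis (- x)"] assms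
  unfolding bs_u_partial_fractions(1)[OF assms] minus_complex.sel plus_complex.sel one_complex.sel
  by (simp add: norm_mult)

lemma Re_bs_phase_deriv:
  assumes "cmod \<alpha> < 1"
  shows "((\<lambda>x. Re (bs_phase \<alpha> (of_real x))) has_real_derivative Re (bs_u \<alpha> x)) (at x)"
  using bounded_linear.has_vector_derivative[OF bounded_linear_Re bs_phase_deriv[OF assms]]
  by (simp add: has_real_derivative_iff_has_vector_derivative)

lemma exp_bs_phase:
  assumes "cmod \<alpha> < 1"
  shows "exp (\<i> * bs_phase \<alpha> (of_real x)) = cis x * ((1 + \<alpha> * cis (- x)) / (1 + \<alpha> * cis x))"
proof -
  have "\<i> * bs_phase \<alpha> (of_real x) = \<i> * of_real x + (Ln (1 + \<alpha> * cis (- x)) - Ln (1 + \<alpha> * cis x))"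
    by (simp add: bs_phase_real algebra_simps flip: mult.assoc)
  then show ?thesis
    using one_plus_nonzero[OF assms, of x] one_plus_nonzero[OF assms, of "- x"]
    by (simp add: exp_add exp_diff cis_conv_exp)
qed

text \<open>Termwise real parts give a real function to which monotonicity and the intermediate
  value theorem apply. For admissible parameters it equals the complex sum, because conjugation
  permutes the summands.\<close>

definition total_phase :: "complex list \<Rightarrow> real \<Rightarrow> real" where
  "total_phase as \<xi> = (\<Sum>\<alpha>\<leftarrow>as. Re (bs_phase \<alpha> (of_real \<xi>)))"

lemma bs_admissible_cmod: "bs_admissible P \<Longrightarrow> \<alpha> \<in> set (alphas P) \<Longrightarrow> cmod \<alpha> < 1"
  by (simp add: bs_admissible_def)

lemma cnj_sum_list: "cnj (sum_list xs) = sum_list (map cnj xs)"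
  by (induction xs) auto

lemma Re_sum_list: "Re (sum_list xs) = sum_list (map Re xs)"
  by (induction xs) auto

lemma sum_bs_phase:
  assumes P: "bs_admissible P"
  shows "(\<Sum>\<alpha>\<leftarrow>alphas P. bs_phase \<alpha> (of_real \<xi>)) = complex_of_real (total_phase (alphas P) \<xi>)"
proof -
  let ?S = "\<Sum>\<alpha>\<leftarrow>alphas P. bs_phase \<alpha> (of_real \<xi>)"
  let ?f = "\<lambda>\<alpha>. bs_phase \<alpha> (of_real \<xi>)"
  have "cnj ?S = sum_list (map ?f (map cnj (alphas P)))"
    using bs_admissible_cmod[OF P] by (auto simp: cnj_sum_list o_def cnj_bs_phase cong: map_cong)
  also have "\<dots> = sum_mset (mset (map ?f (map cnj (alphas P))))"
    by (simp only: sum_mset_sum_list)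
  also have "mset (map ?f (map cnj (alphas P))) = mset (map ?f (alphas P))"
    using P unfolding bs_admissible_def by (simp only: mset_map)
  also have "sum_mset \<dots> = ?S"
    by (simp only: sum_mset_sum_list)
  finally have "?S = complex_of_real (Re ?S)"
    by (metis Reals_cnj_iff complex_is_Real_iff of_real_Re)
  then show ?thesis
    by (simp add: total_phase_def Re_sum_list o_def)
qed

lemma total_phase_mono:
  assumes "\<And>\<alpha>. \<alpha> \<in> set as \<Longrightarrow> cmod \<alpha> < 1" "x \<le> y"
  shows "total_phase as x \<le> total_phase as y"
  unfolding total_phase_def
proof (rule sum_list_mono)
  fix \<alpha> assume "\<alpha> \<in> set as"
  then have "cmod \<alpha> < 1"
    using assms by blast
  show "Re (bs_phase \<alpha> (of_real x)) \<le> Re (bs_phase \<alpha> (of_real y))"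
    using Re_bs_phase_deriv[OF \<open>cmod \<alpha> < 1\<close>] Re_bs_u_pos[OF \<open>cmod \<alpha> < 1\<close>]
    by (intro DERIV_nonneg_imp_nondecreasing[OF assms(2)]) (meson less_imp_le)
qed

lemma continuous_on_total_phase:
  assumes "\<And>\<alpha>. \<alpha> \<in> set as \<Longrightarrow> cmod \<alpha> < 1"
  shows "continuous_on S (total_phase as)"
  using assms
proof (induction as)
  case Nil
  then show ?case
    by (simp add: total_phase_def)
next
  case (Cons \<alpha> as)
  have "continuous_on S (\<lambda>x. Re (bs_phase \<alpha> (of_real x)))"
    using Re_bs_phase_deriv[of \<alpha>] Cons.prems
    by (intro continuous_at_imp_continuous_on) (auto intro: DERIV_isCont)
  moreover have "continuous_on S (total_phase as)"
    using Cons by simp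
  ultimately show ?case
    unfolding total_phase_def by (auto intro: continuous_on_add)
qed

lemma total_phase_0: "total_phase as 0 = 0"
  by (induction as) (auto simp: total_phase_def bs_phase_def)

lemma total_phase_pi: "total_phase as pi = pi * real (length as)"
  by (induction as) (auto simp: total_phase_def bs_phase_pi algebra_simps)

lemma exp_sum_bs_phase:
  assumes "\<And>\<alpha>. \<alpha> \<in> set as \<Longrightarrow> cmod \<alpha> < 1"
  shows "exp (\<i> * (\<Sum>\<alpha>\<leftarrow>as. bs_phase \<alpha> (of_real x))) =
    cis x ^ length as * ((\<Prod>\<alpha>\<leftarrow>as. 1 + \<alpha> * cis (- x)) / (\<Prod>\<alpha>\<leftarrow>as. 1 + \<alpha> * cis x))"
  using assms
proof (induction as)
  case (Cons \<alpha> as)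
  then have "cmod \<alpha> < 1"
    by simp
  with Cons show ?case
    by (simp add: distrib_left exp_add exp_bs_phase)
qed simp

text \<open>Exponentiated, the phases give z^d times a quotient of \<alpha>-products, with z =
  \<open>cis \<xi>\<close> and d the number of parameters. Subtracting 2 \<open>d_eps\<close> \<xi>
  leaves one power of z per sign factor, absorbed by z (1 + 1/z) = 1 + z and z (1 - 1/z) = -(1 - z).
  The latter is the source of the sign.\<close>

lemma cis_phase_eq_ratio:
  assumes P: "bs_admissible P" and reg: "szego P (cis \<xi>) \<noteq> 0"
  shows "cis (total_phase (alphas P) \<xi> - 2 * d_eps P * \<xi>) =
    (- 1) ^ eps_minus P * (bs_c P \<xi> / bs_c P (- \<xi>))"
proof -
  let ?z = "cis \<xi>" and ?A = "\<Prod>\<alpha>\<leftarrow>alphas P. 1 + \<alpha> * cis (- \<xi>)" and ?B = "\<Prod>\<alpha>\<leftarrow>alphas P. 1 + \<alpha> * cis \<xi>"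
  have reg': "szego P (cis (- \<xi>)) \<noteq> 0"
    using reg szego_minus_nonzero[OF P] by simp
  have nz: "?A \<noteq> 0" "?B \<noteq> 0"
    using alpha_prod_nonzero[OF P, of ?z] alpha_prod_nonzero[OF P, of "cis (- \<xi>)"] by auto
  have "cis (total_phase (alphas P) \<xi>) = ?z ^ length (alphas P) * (?A / ?B)"
    using exp_sum_bs_phase[of "alphas P" \<xi>] bs_admissible_cmod[OF P]
    by (simp add: sum_bs_phase[OF P] cis_conv_exp)
  moreover have "cis (2 * d_eps P * \<xi>) = ?z ^ length (alphas P) / ?z ^ (eps_plus P + eps_minus P)"
    by (simp add: Complex.DeMoivre cis_divide d_eps_def algebra_simps add_divide_distrib diff_divide_distrib)
  ultimately have "cis (total_phase (alphas P) \<xi> - 2 * d_eps P * \<xi>) = ?z ^ (eps_plus P + eps_minus P) * (?A / ?B)"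
    by (simp flip: cis_divide)
  also have "\<dots> = (- 1) ^ eps_minus P * (szego P ?z / szego P (cis (- \<xi>)))"
  proof -
    have zz: "?z * cis (- \<xi>) = 1"
      by (simp add: cis_mult)
    have fac: "1 + of_nat (eps_plus P) * cis (- \<xi>) \<noteq> 0" "1 - of_nat (eps_minus P) * cis (- \<xi>) \<noteq> 0"
      using reg' by (auto simp: szego_def)
    have "eps_plus P = 0 \<or> eps_plus P = 1" "eps_minus P = 0 \<or> eps_minus P = 1"
      using P by (auto simp: bs_admissible_def)
    then have "?z ^ eps_plus P * (1 + of_nat (eps_plus P) * cis (- \<xi>)) = 1 + of_nat (eps_plus P) * ?z"
      "?z ^ eps_minus P * (1 - of_nat (eps_minus P) * cis (- \<xi>)) = (- 1) ^ eps_minus P * (1 - of_nat (eps_minus P) * ?z)"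
      using zz by (auto simp: distrib_left right_diff_distrib)
    then have a: "?z ^ eps_plus P = (1 + of_nat (eps_plus P) * ?z) / (1 + of_nat (eps_plus P) * cis (- \<xi>))"
      and b: "?z ^ eps_minus P = (- 1) ^ eps_minus P * (1 - of_nat (eps_minus P) * ?z) / (1 - of_nat (eps_minus P) * cis (- \<xi>))"
      using fac by (simp_all add: nonzero_eq_divide_eq)
    show ?thesis
      unfolding power_add a b szego_def by (simp add: mult_ac)
  qed
  finally show ?thesis
    by (simp add: bs_c_szego divide_inverse)
qed

lemma bs_node_properties:
  assumes P: "bs_admissible P" and Q: "bs_admissible Q"
    and m: "int m > \<lceil>d_eps P\<rceil> + \<lceil>d_eps Q\<rceil>" and j: "j \<le> m"
  defines "\<xi> \<equiv> bs_node P Q m j"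
  shows "szego P (cis \<xi>) \<noteq> 0" and "szego Q (cis \<xi>) \<noteq> 0"
    and "cis (2 * real m * \<xi>) * (bs_c P \<xi> / bs_c P (- \<xi>)) * (bs_c Q \<xi> / bs_c Q (- \<xi>)) = 1"
proof -
  define \<kappa> where "\<kappa> = real m - d_eps P - d_eps Q"
  define H where "H x = 2 * \<kappa> * x + total_phase (alphas P) x + total_phase (alphas Q) x" for x
  define r where "r = pi * (2 * real j + real (eps_minus P) + real (eps_minus Q))"
  have "real_of_int (\<lceil>d_eps P\<rceil> + \<lceil>d_eps Q\<rceil>) < real m"
    using m by linarith
  then have "\<kappa> > 0"
    using le_of_int_ceiling[of "d_eps P"] le_of_int_ceiling[of "d_eps Q"] unfolding \<kappa>_def by linarith
  have mono: "H x < H y" if "x < y" for x y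
  proof -
    have "2 * \<kappa> * x < 2 * \<kappa> * y"
      using \<open>\<kappa> > 0\<close> that by simp
    then show ?thesis
      using total_phase_mono[of "alphas P" x y] total_phase_mono[of "alphas Q" x y] that
        bs_admissible_cmod[OF P] bs_admissible_cmod[OF Q] unfolding H_def by fastforce
  qed
  have H_0: "H 0 = 0"
    by (simp add: H_def total_phase_0)
  \<comment> \<open>The lengths of the parameter lists cancel against \<open>d_eps\<close>; since j
    \<le> m, the level r does not exceed this value and a solution exists in [0, pi].\<close>
  have H_pi: "H pi = pi * (2 * real m + real (eps_plus P) + real (eps_minus P) + real (eps_plus Q) + real (eps_minus Q))"
    by (simp add: H_def total_phase_pi \<kappa>_def d_eps_def algebra_simps add_divide_distrib diff_divide_distrib)
  have "continuous_on {0..pi} H"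
    unfolding H_def using bs_admissible_cmod[OF P] bs_admissible_cmod[OF Q]
    by (intro continuous_intros continuous_on_total_phase)
  moreover have "H 0 \<le> r" "r \<le> H pi"
    using j by (auto simp: H_0 H_pi r_def intro!: mult_left_mono)
  ultimately obtain x where x: "0 \<le> x" "x \<le> pi" "H x = r"
    using IVT'[of H 0 r pi] by auto
  have eq_iff: "complex_of_real (2 * (real m - d_eps P - d_eps Q) * y) +
     (\<Sum>\<alpha>\<leftarrow>alphas P. LBINT x=0..y. bs_u \<alpha> x) + (\<Sum>\<alpha>\<leftarrow>alphas Q. LBINT x=0..y. bs_u \<alpha> x) =
     complex_of_real (pi * (2 * real j + real (eps_minus P) + real (eps_minus Q))) \<longleftrightarrow> H y = r" for y
  proof -
    have "(\<Sum>\<alpha>\<leftarrow>alphas R. LBINT x=0..y. bs_u \<alpha> x) = complex_of_real (total_phase (alphas R) y)"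
      if "bs_admissible R" for R
      unfolding sum_bs_phase[OF that, symmetric]
      using bs_admissible_cmod[OF that] by (intro arg_cong[of _ _ sum_list] map_cong) (auto simp: integral_bs_u)
    note this[OF P] this[OF Q]
    then show ?thesis
      unfolding H_def r_def \<kappa>_def by (simp only: of_real_add[symmetric] of_real_eq_iff)
  qed
  have "\<xi> = x"
    unfolding \<xi>_def bs_node_def eq_iff
  proof (rule the_equality[where P = "\<lambda>y. H y = r"])
    show "H x = r" by (rule x)
    show "y = x" if "H y = r" for y
      using mono[of x y] mono[of y x] x(3) that by (cases x y rule: linorder_cases) auto
  qed
  with x have \<xi>: "0 \<le> \<xi>" "\<xi> \<le> pi" "H \<xi> = r"
    by auto
  \<comment> \<open>A node at 0 forces r = 0 and both \<open>eps_minus\<close> to be 0; a node at pi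
    forces j = m and both \<open>eps_plus\<close> to be 0. So no node is a pole of either c.\<close>
  have left: "\<xi> \<noteq> 0" if "eps_minus P = 1 \<or> eps_minus Q = 1"
  proof
    assume "\<xi> = 0"
    with \<xi> H_0 have "r = 0"
      by simp
    with that show False
      by (auto simp: r_def)
  qed
  have right: "\<xi> \<noteq> pi" if "eps_plus P = 1 \<or> eps_plus Q = 1"
  proof
    assume "\<xi> = pi"
    with \<xi> H_pi have "2 * real j + real (eps_minus P) + real (eps_minus Q) =
        2 * real m + real (eps_plus P) + real (eps_minus P) + real (eps_plus Q) + real (eps_minus Q)"
      by (simp add: r_def)
    with that j show False
      by auto
  qed
  show reg: "szego P (cis \<xi>) \<noteq> 0" "szego Q (cis \<xi>) \<noteq> 0"
    using left right \<xi> by (auto simp: szego_nonzero_iff P Q cis_eq_1_iff cis_eq_minus_1_iff)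
  \<comment> \<open>The shift by \<open>eps_minus\<close> in the node equation produces the same
    sign as \<open>cis_phase_eq_ratio\<close>, so the two cancel.\<close>
  let ?s = "(- 1 :: complex) ^ eps_minus P * (- 1) ^ eps_minus Q"
  have "H \<xi> = 2 * real m * \<xi> + (total_phase (alphas P) \<xi> - 2 * d_eps P * \<xi>) + (total_phase (alphas Q) \<xi> - 2 * d_eps Q * \<xi>)"
    by (simp add: H_def \<kappa>_def algebra_simps)
  then have "cis (H \<xi>) = cis (2 * real m * \<xi>) * cis (total_phase (alphas P) \<xi> - 2 * d_eps P * \<xi>) *
      cis (total_phase (alphas Q) \<xi> - 2 * d_eps Q * \<xi>)"
    by (simp only: cis_mult)
  then have "cis (2 * real m * \<xi>) * (bs_c P \<xi> / bs_c P (- \<xi>)) * (bs_c Q \<xi> / bs_c Q (- \<xi>)) * ?s = cis (H \<xi>)"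
    unfolding cis_phase_eq_ratio[OF P reg(1)] cis_phase_eq_ratio[OF Q reg(2)] by (simp only: mult_ac)
  also have "cis (H \<xi>) = ?s"
  proof -
    have "r = 2 * pi * real j + real (eps_minus P) * pi + real (eps_minus Q) * pi"
      by (simp add: r_def algebra_simps)
    moreover have "cis (real n * pi) = (- 1) ^ n" for n
      by (simp flip: Complex.DeMoivre)
    moreover have "cis (2 * pi * real j) = 1"
      by (simp add: cis_multiple_2pi)
    ultimately show ?thesis
      unfolding \<xi>(3) by (simp flip: cis_mult)
  qed
  finally have cancel: "cis (2 * real m * \<xi>) * (bs_c P \<xi> / bs_c P (- \<xi>)) * (bs_c Q \<xi> / bs_c Q (- \<xi>)) * ?s = ?s" .
  have "x = 1" if "x * ?s = ?s" for x
    using that by simp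
  from this[OF cancel]
  show "cis (2 * real m * \<xi>) * (bs_c P \<xi> / bs_c P (- \<xi>)) * (bs_c Q \<xi> / bs_c Q (- \<xi>)) = 1" .
qed

section \<open>The eigenvalue equation\<close>

text \<open>The values of \<open>d_eps\<close> are half-integers not below -1, and -1/2 has ceiling
  0, so only -1 itself remains.\<close>

lemma d_eps_negative:
  assumes P: "bs_admissible P" and "\<lceil>d_eps P\<rceil> < 0"
  shows "alphas P = []" "eps_plus P = 1" "eps_minus P = 1" "d_eps P = - 1"
proof -
  have "d_eps P \<le> - 1"
    using assms(2) by linarith
  then have "real (length (alphas P) + 2) \<le> real (eps_plus P + eps_minus P)"
    by (simp add: d_eps_def)
  then have "length (alphas P) + 2 \<le> eps_plus P + eps_minus P"
    unfolding of_nat_le_iff .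
  moreover have "eps_plus P \<le> 1" "eps_minus P \<le> 1"
    using P by (auto simp: bs_admissible_def)
  ultimately have "length (alphas P) = 0" "eps_plus P = 1" "eps_minus P = 1"
    by linarith+
  then show "alphas P = []" "eps_plus P = 1" "eps_minus P = 1"
    by auto
  then show "d_eps P = - 1"
    by (simp add: d_eps_def)
qed

text \<open>With this ratio the incident and the reflected wave cancel one site beyond the boundary,
  which is how a row with a missing neighbour still solves the free equation.\<close>

lemma bs_c_ratio_negative:
  assumes P: "bs_admissible P" and "\<lceil>d_eps P\<rceil> < 0" and reg: "szego P (cis \<xi>) \<noteq> 0"
  shows "bs_c P \<xi> / bs_c P (- \<xi>) = - cis (2 * \<xi>)"
  using cis_phase_eq_ratio[OF P reg] d_eps_negative[OF assms(1,2)]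
  by (simp add: total_phase_def)

lemma sum_delta:
  fixes f :: "nat \<Rightarrow> 'a::semiring_1"
  shows "(\<Sum>k<Suc m. (a * of_bool (l = k + 1) + b * of_bool (l = k) + c * of_bool (l + 1 = k)) * f k) =
    (if 1 \<le> l \<and> l \<le> Suc m then a * f (l - 1) else 0) + (if l \<le> m then b * f l else 0) + (if l + 1 \<le> m then c * f (l + 1) else 0)"
proof -
  have "(\<Sum>k<Suc m. a * of_bool (l = k + 1) * f k) = (if 1 \<le> l \<and> l \<le> Suc m then a * f (l - 1) else 0)"
  proof (cases l)
    case (Suc j)
    have "(\<Sum>k<Suc m. a * of_bool (l = k + 1) * f k) = (\<Sum>k<Suc m. if k = j then a * f j else 0)"
      using Suc by (intro sum.cong) auto
    then show ?thesis
      using Suc by auto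
  qed simp
  moreover have "(\<Sum>k<Suc m. b * of_bool (l = k) * f k) = (\<Sum>k<Suc m. if k = l then b * f l else 0)"
    by (intro sum.cong) auto
  moreover have "(\<Sum>k<Suc m. c * of_bool (l + 1 = k) * f k) = (\<Sum>k<Suc m. if k = l + 1 then c * f (l + 1) else 0)"
    by (intro sum.cong) auto
  ultimately show ?thesis
    by (simp add: distrib_right sum.distrib)
qed

lemma tridiagonal_mult_vec_nth:
  assumes "l \<le> m"
    and row: "\<And>k. bs_L_entry P Q m l k = a * of_bool (l = k + 1) + b * of_bool (l = k) + c * of_bool (l + 1 = k)"
  shows "(bs_L P Q m *\<^sub>v Matrix.vec (m + 1) f) $ l =
    (if l = 0 then 0 else of_real a * f (l - 1)) + of_real b * f l + (if l = m then 0 else of_real c * f (l + 1))"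
proof -
  have "(bs_L P Q m *\<^sub>v Matrix.vec (m + 1) f) $ l =
      (\<Sum>k<Suc m. (of_real a * of_bool (l = k + 1) + of_real b * of_bool (l = k) + of_real c * of_bool (l + 1 = k)) * f k)"
    using assms(1) by (auto simp: bs_L_def scalar_prod_def row lessThan_atLeast0 of_bool_def intro!: sum.cong)
  also have "\<dots> = (if l = 0 then 0 else of_real a * f (l - 1)) + of_real b * f l + (if l = m then 0 else of_real c * f (l + 1))"
    unfolding sum_delta using assms(1) by auto
  finally show ?thesis .
qed

text \<open>In the overlap both halves of \<open>\<psi>\<close> are the plane-wave combination \<open>F\<close>, which is
  defined for all integers and solves the free equation. A boundary row in which a neighbour is
  missing is correct because \<open>F (- 1)\<close> or \<open>F (m + 1)\<close> vanishes when \<open>d_eps = - 1\<close>; otherwise it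
  is covered by the three-term recurrence at index \<open>0\<close>.\<close>

theorem proposition2:
  fixes P Q :: bs_params and m :: nat and \<xi> :: real
  assumes "bs_admissible P" and "bs_admissible Q"
    and "0 < m" and "int m > \<lceil>d_eps P\<rceil> + \<lceil>d_eps Q\<rceil>"
    and "\<xi> \<in> bs_node P Q m ` {0..m}"
  shows "bs_L P Q m *\<^sub>v bs_psi P Q m \<xi> =
         complex_of_real (2 * cos \<xi>) \<cdot>\<^sub>v bs_psi P Q m \<xi>"
proof -
  note P = assms(1) and Q = assms(2)
  obtain j where j: "j \<le> m" and \<xi>: "\<xi> = bs_node P Q m j"
    using assms(5) by auto
  have reg: "szego P (cis \<xi>) \<noteq> 0" "szego Q (cis \<xi>) \<noteq> 0"
    and node: "cis (2 * real m * \<xi>) * (bs_c P \<xi> / bs_c P (- \<xi>)) * (bs_c Q \<xi> / bs_c Q (- \<xi>)) = 1"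
    using bs_node_properties[OF P Q assms(4) j] by (simp_all add: \<xi>)
  have c_nz: "bs_c P \<xi> \<noteq> 0" "bs_c P (- \<xi>) \<noteq> 0" "bs_c Q \<xi> \<noteq> 0" "bs_c Q (- \<xi>) \<noteq> 0"
    using reg szego_minus_nonzero[OF P] szego_minus_nonzero[OF Q] by (auto simp: bs_c_szego)
  define \<rho> where "\<rho> = bs_c P \<xi> / bs_c P (- \<xi>)"
  define E where "E = cis (real m * \<xi> / 2)"
  have E: "exp (\<i> / 2 * of_nat m * of_real \<xi>) = E" "exp (- \<i> / 2 * of_nat m * of_real \<xi>) = cis (- (real m * \<xi> / 2))"
    by (simp_all add: E_def cis_conv_exp mult_ac)
  define f where "f k = E * (of_real (bs_pn P k \<xi>) / bs_c P (- \<xi>))" for k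
  define g where "g k = cis (- (real m * \<xi> / 2)) * (of_real (bs_pn Q k \<xi>) / bs_c Q \<xi>)" for k
  define F where "F x = E * (cis (x * \<xi>) * \<rho> + cis (- (x * \<xi>)))" for x :: real
  define C where "C = complex_of_real (2 * cos \<xi>)"
  define \<psi> where "\<psi> k = (if real k \<le> real m - d_eps Q then f k else g (m - k))" for k
  have psi: "bs_psi P Q m \<xi> = Matrix.vec (m + 1) \<psi>"
    unfolding bs_psi_def \<psi>_def f_def g_def E ..
  have f_rec: "C * f l = (if l = 0 then 0 else f (l - 1)) + of_real (bs_b P l) * f l + of_real ((bs_a P (l + 1))\<^sup>2) * f (l + 1)" for l
    using arg_cong[OF bs_pn_recurrence[OF P, of \<xi> l], of "\<lambda>x. E / bs_c P (- \<xi>) * complex_of_real x"]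
    by (cases "l = 0") (simp_all add: f_def C_def algebra_simps add_divide_distrib)
  have g_rec: "C * g l = (if l = 0 then 0 else g (l - 1)) + of_real (bs_b Q l) * g l + of_real ((bs_a Q (l + 1))\<^sup>2) * g (l + 1)" for l
    using arg_cong[OF bs_pn_recurrence[OF Q, of \<xi> l], of "\<lambda>x. cis (- (real m * \<xi> / 2)) / bs_c Q \<xi> * complex_of_real x"]
    by (cases "l = 0") (simp_all add: g_def C_def algebra_simps add_divide_distrib)
  have F_rec: "C * F x = F (x - 1) + F (x + 1)" for x
  proof -
    have "C * cis y = cis (y - \<xi>) + cis (y + \<xi>)" for y
      by (simp add: C_def complex_eq_iff cos_add cos_diff sin_add sin_diff)
    note cis_C = this[of "x * \<xi>"] this[of "- (x * \<xi>)"]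
    have "C * F x = E * (C * cis (x * \<xi>) * \<rho> + C * cis (- (x * \<xi>)))"
      by (simp add: F_def algebra_simps)
    moreover have "(x - 1) * \<xi> = x * \<xi> - \<xi>" "- (x * \<xi> - \<xi>) = - (x * \<xi>) + \<xi>"
      "(x + 1) * \<xi> = x * \<xi> + \<xi>" "- (x * \<xi> + \<xi>) = - (x * \<xi>) - \<xi>"
      by (simp_all add: algebra_simps)
    ultimately show ?thesis
      by (simp only: cis_C F_def ring_distribs add_ac)
  qed
  have f_F: "f k = F (real k)" if "d_eps P \<le> real k" for k
    using c_nz unfolding f_def F_def bs_pn_explicit[OF P that reg(1)] \<rho>_def
    by (simp add: add_divide_distrib)
  have g_F: "g k = F (real m - real k)" if "d_eps Q \<le> real k" for k
  proof -
    \<comment> \<open>Here the quantization condition enters: it trades the reflection ratio of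
      \<open>Q\<close> for that of \<open>P\<close>, and the factor exp (2 i m \<xi>) converts
      positions counted from m into positions counted from 0.\<close>
    have \<rho>: "bs_c Q (- \<xi>) / bs_c Q \<xi> = cis (2 * real m * \<xi>) * \<rho>"
      using node c_nz by (simp add: \<rho>_def field_simps)
    have "g k = cis (- (real m * \<xi> / 2)) * (cis (real k * \<xi>) + cis (- (real k * \<xi>)) * (cis (2 * real m * \<xi>) * \<rho>))"
      unfolding g_def bs_pn_explicit[OF Q that reg(2)] \<rho>[symmetric] using c_nz by (simp add: add_divide_distrib)
    also have "\<dots> = cis (- (real m * \<xi> / 2) + real k * \<xi>) + cis (- (real m * \<xi> / 2) - real k * \<xi> + 2 * real m * \<xi>) * \<rho>"
      by (simp add: distrib_left cis_mult flip: mult.assoc)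
    also have "\<dots> = F (real m - real k)"
      unfolding F_def E_def by (simp add: distrib_left cis_mult flip: mult.assoc) (simp add: algebra_simps)
    finally show ?thesis .
  qed
  have F_left: "F (- 1) = 0" if "\<lceil>d_eps P\<rceil> < 0"
    using bs_c_ratio_negative[OF P that reg(1)] by (simp add: F_def \<rho>_def cis_mult)
  have F_right: "F (real m + 1) = 0" if "\<lceil>d_eps Q\<rceil> < 0"
  proof -
    have "cis (2 * real m * \<xi>) * \<rho> * (- cis (2 * \<xi>)) = 1"
      using node unfolding bs_c_ratio_negative[OF Q that reg(2)] \<rho>_def .
    then have "cis (2 * real m * \<xi> + 2 * \<xi>) * \<rho> = - 1"
      by (simp add: minus_equation_iff[of _ 1] mult_ac flip: cis_mult)
    moreover have "cis ((real m + 1) * \<xi>) = cis (- ((real m + 1) * \<xi>)) * cis (2 * real m * \<xi> + 2 * \<xi>)"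
      by (simp add: cis_mult algebra_simps)
    ultimately show ?thesis
      by (simp add: F_def mult.assoc)
  qed
  \<comment> \<open>The matrix is divided at ceilings, \<psi> at the possibly fractional
    \<open>d_eps\<close>. The bounds with ceilings imply those with \<open>d_eps\<close>.\<close>
  have \<psi>_f: "\<psi> k = f k" if "int k \<le> int m - \<lceil>d_eps Q\<rceil>" for k
  proof -
    have "real k \<le> real m - d_eps Q"
      using that by linarith
    then show ?thesis
      by (simp add: \<psi>_def)
  qed
  have \<psi>_F: "\<psi> k = F (real k)" if "\<lceil>d_eps P\<rceil> \<le> int k" "int k \<le> int m - \<lceil>d_eps Q\<rceil>" for k
  proof -
    have "d_eps P \<le> real k"
      using that(1) by linarith
    then show ?thesis
      using \<psi>_f[OF that(2)] f_F by simp
  qed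
  have \<psi>_g: "\<psi> k = g (m - k)" if "\<lceil>d_eps P\<rceil> \<le> int k" "k \<le> m" for k
  proof (cases "real k \<le> real m - d_eps Q")
    case True
    have "d_eps P \<le> real k"
      using that(1) by linarith
    with True that(2) show ?thesis
      using f_F[of k] g_F[of "m - k"] by (simp add: \<psi>_def of_nat_diff)
  qed (simp add: \<psi>_def)
  have row: "(bs_L P Q m *\<^sub>v Matrix.vec (m + 1) \<psi>) $ l = C * \<psi> l" if "l \<le> m" for l
  proof -
    consider (left) "int l \<le> \<lceil>d_eps P\<rceil>" | (middle) "\<lceil>d_eps P\<rceil> < int l" "int l < int m - \<lceil>d_eps Q\<rceil>"
      | (right) "\<lceil>d_eps P\<rceil> < int l" "int m - \<lceil>d_eps Q\<rceil> \<le> int l"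
      by linarith
    then show ?thesis
    proof cases
      case left
      \<comment> \<open>The last row falls into the left block only when \<open>d_eps Q\<close> is
        -1. The neighbour missing from the matrix is then F (m + 1) = 0.\<close>
      have last: "f (l + 1) = 0" if "l = m"
      proof -
        have neg: "\<lceil>d_eps Q\<rceil> < 0"
          using left assms(4) that by linarith
        then have "d_eps P \<le> real (l + 1)"
          using assms(4) d_eps_negative(4)[OF Q neg] that by linarith
        with neg show ?thesis
          using f_F[of "l + 1"] F_right that by (simp add: add.commute)
      qed
      have "bs_L_entry P Q m l k = 1 * of_bool (l = k + 1) + bs_b P l * of_bool (l = k) + (bs_a P (l + 1))\<^sup>2 * of_bool (l + 1 = k)" for k
        using left by (simp add: bs_L_entry_def)
      \<comment> \<open>The strict lower bound on m is used here: l + 1 \<le> \<lceil>d_eps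
        P\<rceil> + 1 \<le> m - \<lceil>d_eps Q\<rceil>, so the upper neighbour is still given by
        \<open>f\<close>.\<close>
      from tridiagonal_mult_vec_nth[OF \<open>l \<le> m\<close> this, of \<psi>]
      show ?thesis
        using left assms(4) last by (auto simp: \<psi>_f f_rec of_nat_diff)
    next
      case middle
      have neighbours: "(if l = 0 then 0 else \<psi> (l - 1)) = F (real l - 1)" "(if l = m then 0 else \<psi> (l + 1)) = F (real l + 1)"
        using middle F_left F_right \<psi>_F[of "l - 1"] \<psi>_F[of "l + 1"] by (auto simp: of_nat_diff add.commute)
      have "bs_L_entry P Q m l k = 1 * of_bool (l = k + 1) + 0 * of_bool (l = k) + 1 * of_bool (l + 1 = k)" for k
        using middle by (simp add: bs_L_entry_def)
      from tridiagonal_mult_vec_nth[OF \<open>l \<le> m\<close> this, of \<psi>]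
      have "(bs_L P Q m *\<^sub>v Matrix.vec (m + 1) \<psi>) $ l = (if l = 0 then 0 else \<psi> (l - 1)) + (if l = m then 0 else \<psi> (l + 1))"
        by simp
      then show ?thesis
        unfolding neighbours using middle by (simp add: \<psi>_F F_rec)
    next
      case right
      \<comment> \<open>Mirror image of \<open>last\<close>: row 0 lies in the right block only when
        \<open>d_eps P\<close> is -1, and then g (m + 1) = F (-1) = 0.\<close>
      have first: "g (m - l + 1) = 0" if "l = 0"
      proof -
        have neg: "\<lceil>d_eps P\<rceil> < 0"
          using right that by linarith
        then have "d_eps Q \<le> real (m - l + 1)"
          using assms(4) d_eps_negative(4)[OF P neg] that by linarith
        with neg show ?thesis
          using g_F[of "m - l + 1"] F_left that by simp
      qed
      have "bs_L_entry P Q m l k = (bs_a Q (m - l + 1))\<^sup>2 * of_bool (l = k + 1) + bs_b Q (m - l) * of_bool (l = k) + 1 * of_bool (l + 1 = k)" for k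
        using right by (simp add: bs_L_entry_def)
      from tridiagonal_mult_vec_nth[OF \<open>l \<le> m\<close> this, of \<psi>]
      have "(bs_L P Q m *\<^sub>v Matrix.vec (m + 1) \<psi>) $ l =
          (if l = 0 then 0 else of_real ((bs_a Q (m - l + 1))\<^sup>2) * \<psi> (l - 1)) + of_real (bs_b Q (m - l)) * \<psi> l + (if l = m then 0 else \<psi> (l + 1))"
        by simp
      also have "(if l = 0 then 0 else of_real ((bs_a Q (m - l + 1))\<^sup>2) * \<psi> (l - 1)) = of_real ((bs_a Q (m - l + 1))\<^sup>2) * g (m - l + 1)"
      proof (cases "l = 0")
        case False
        then have "\<psi> (l - 1) = g (m - (l - 1))"
          using right \<open>l \<le> m\<close> by (intro \<psi>_g) auto
        moreover have "m - (l - 1) = m - l + 1"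
          using False \<open>l \<le> m\<close> by simp
        ultimately show ?thesis
          using False by simp
      qed (use first in simp)
      also have "(if l = m then 0 else \<psi> (l + 1)) = (if m - l = 0 then 0 else g (m - l - 1))"
        using right \<open>l \<le> m\<close> \<psi>_g[of "l + 1"] by auto
      also have "\<psi> l = g (m - l)"
        using right \<open>l \<le> m\<close> by (intro \<psi>_g) auto
      finally show ?thesis
        using g_rec[of "m - l"] \<psi>_g[of l] right \<open>l \<le> m\<close> by (simp add: algebra_simps)
    qed
  qed
  show ?thesis
    unfolding psi
  proof (rule eq_vecI)
    fix l assume "l < dim_vec (complex_of_real (2 * cos \<xi>) \<cdot>\<^sub>v Matrix.vec (m + 1) \<psi>)"
    then have "l \<le> m"
      by simp
    then show "(bs_L P Q m *\<^sub>v Matrix.vec (m + 1) \<psi>) $ l = (complex_of_real (2 * cos \<xi>) \<cdot>\<^sub>v Matrix.vec (m + 1) \<psi>) $ l"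
      unfolding row[OF \<open>l \<le> m\<close>] by (simp add: C_def)
  qed (simp add: bs_L_def)
qed

end
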